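(* There are exactly two isomorphism classes of $AC(\sigma)$ spaces with $\sigma$ a real $C$-set; that is, the relation "isomorphic as Banach algebras" partitions the collection $\{AC(\sigma) : \sigma \text{ a real } C\text{-set}\}$ into exactly two equivalence classes.
   Context: Identify $\mathbb{C}$ with $\mathbb{R}^2$. Let $\sigma$ be a nonempty compact subset of the plane; all functions are complex-valued. Variation factor. Let $S=[x_0,x_1,\dots,x_n]$ be a finite ordered list of (not necessarily distinct) elements of $\sigma$, $n\ge 1$. For $f:\sigma\to\mathbb{C}$ put $\mathrm{cvar}(f,S)=\sum_{i=1}^n |f(x_i)-f(x_{i-1})|$. For a line $L$ in the plane, the segment from $x_i$ to $x_{i+1}$ ($0\le i\le n-1$) is a crossing segment of $S$ on $L$ if any one of the following holds: (i) $x_i$ and $x_{i+1}$ lie on strictly opposite sides of $L$; (ii) $i=0$ and $x_i\in L$; (iii) $i>0$, $x_i\in L$ and $x_{i-1}\notin L$; (iv) $i=n-1$, $x_i\notin L$ and $x_{i+1}\in L$. Let $\mathrm{vf}(S,L)$ be the number of indices $i$ giving a crossing segment of $S$ on $L$, and $\mathrm{vf}(S)=\max_L \mathrm{vf}(S,L)$ over all lines $L$. For a one-element list, $\mathrm{cvar}(f,[x_0])=0$ and $\mathrm{vf}([x_0])=1$. The spaces. $\mathrm{var}(f,\sigma)=\sup_S \mathrm{cvar}(f,S)/\mathrm{vf}(S)$, the supremum being over all finite ordered lists of elements of $\sigma$; $\|f\|_{BV(\sigma)}=\|f\|_\infty+\mathrm{var}(f,\sigma)$; $BV(\sigma)=\{f:\sigma\to\mathbb{C}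 : \|f\|_{BV(\sigma)}<\infty\}$, which is a Banach algebra under pointwise operations. $AC(\sigma)$ is the closure in $BV(\sigma)$ of the set of restrictions to $\sigma$ of complex polynomials $p(x,y)=\sum_{n,m}c_{nm}x^ny^m$ in two real variables; it is a closed subalgebra of $BV(\sigma)$. Banach algebras $\mathcal{A},\mathcal{B}$ are isomorphic (as Banach algebras) if there is a linear multiplicative bijection $\Phi:\mathcal{A}\to\mathcal{B}$ with $\Phi$ and $\Phi^{-1}$ continuous (not necessarily isometric). A $C$-set is a countably infinite compact subset of $\mathbb{C}$ with unique limit point $0$; it is a real $C$-set if moreover it is contained in $\mathbb{R}$. *)

theory Defs
  imports "HOL-Analysis.Analysis"
begin

text \<open>The plane is \<^typ>\<open>complex\<close> with its real inner product
  \<^prop>\<open>inner z w = Re z * Re w + Im z * Im w\<close>.\<close>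

definition plane_line :: "complex set \<Rightarrow> bool" where
  "plane_line L \<longleftrightarrow> (\<exists>u c. u \<noteq> 0 \<and> L = {z. inner u z = c})"

text \<open>Replacing \<open>u, c\<close> by their negatives shows that this relation is symmetric in \<open>x\<close> and \<open>y\<close>.\<close>

definition opposite_sides :: "complex set \<Rightarrow> complex \<Rightarrow> complex \<Rightarrow> bool" where
  "opposite_sides L x y \<longleftrightarrow>
     (\<exists>u c. u \<noteq> 0 \<and> L = {z. inner u z = c} \<and> inner u x < c \<and> c < inner u y)"

text \<open>A list \<open>S = [x\<^sub>0, \<dots>, x\<^sub>n]\<close> has \<open>n = length S - 1\<close> segments, indexed by \<open>i < n\<close>.\<close>

definition cvar :: "(complex \<Rightarrow> complex) \<Rightarrow> complex list \<Rightarrow> real" where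
  "cvar f S = (\<Sum>i<length S - 1. norm (f (S ! (i + 1)) - f (S ! i)))"

definition crossing_segment :: "complex list \<Rightarrow> complex set \<Rightarrow> nat \<Rightarrow> bool" where
  "crossing_segment S L i \<longleftrightarrow>
     opposite_sides L (S ! i) (S ! (i + 1)) \<or>
     (i = 0 \<and> S ! i \<in> L) \<or>
     (i > 0 \<and> S ! i \<in> L \<and> S ! (i - 1) \<notin> L) \<or>
     (i + 1 = length S - 1 \<and> S ! i \<notin> L \<and> S ! (i + 1) \<in> L)"

definition vf_line :: "complex list \<Rightarrow> complex set \<Rightarrow> nat" where
  "vf_line S L = card {i. i < length S - 1 \<and> crossing_segment S L i}"

definition vf :: "complex list \<Rightarrow> nat" where
  "vf S = (if length S = 1 then 1 else Max (vf_line S ` Collect plane_line))"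

text \<open>The maximum in \<^const>\<open>vf\<close> ranges over a finite nonempty set and is positive.\<close>

lemma finite_vf_line_image: "finite (vf_line S ` X)"
proof (rule finite_subset)
  show "vf_line S ` X \<subseteq> {..length S - 1}"
  proof
    fix k assume "k \<in> vf_line S ` X"
    then obtain L where k: "k = card {i. i < length S - 1 \<and> crossing_segment S L i}"
      by (auto simp: vf_line_def)
    have "k \<le> card {..<length S - 1}"
      unfolding k by (rule card_mono) auto
    then show "k \<in> {..length S - 1}" by simp
  qed
qed simp

lemma vf_pos:
  assumes "S \<noteq> []"
  shows "vf S \<ge> 1"
proof (cases "length S = 1")
  case True
  then show ?thesis by (simp add: vf_def)
next
  case False
  with assms have len: "0 < length S - 1" by (cases S) auto
  define L where "L = {z::complex. inner 1 z = inner 1 (S ! 0)}"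
  have L: "plane_line L" unfolding plane_line_def L_def
    by (intro exI[of _ 1] exI[of _ "inner 1 (S ! 0)"]) simp
  have "0 \<in> {i. i < length S - 1 \<and> crossing_segment S L i}"
    using len by (simp add: crossing_segment_def L_def)
  then have "vf_line S L \<ge> 1"
    unfolding vf_line_def by (simp only: Suc_le_eq One_nat_def card_gt_0_iff) force
  also have "vf_line S L \<le> Max (vf_line S ` Collect plane_line)"
    using L by (intro Max_ge finite_vf_line_image) auto
  finally show ?thesis using False by (simp add: vf_def)
qed

text \<open>A function on \<open>\<sigma>\<close> is represented by its extension by \<open>0\<close> to the whole plane.  Variation and
  norm are first taken in \<^typ>\<open>ennreal\<close>, so that the suprema exist unconditionally.\<close>

definition var :: "complex set \<Rightarrow> (complex \<Rightarrow> complex) \<Rightarrow> ennreal" where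
  "var \<sigma> f = (SUP S\<in>{S. S \<noteq> [] \<and> set S \<subseteq> \<sigma>}. ennreal (cvar f S / real (vf S)))"

definition eBV_norm :: "complex set \<Rightarrow> (complex \<Rightarrow> complex) \<Rightarrow> ennreal" where
  "eBV_norm \<sigma> f = (SUP z\<in>\<sigma>. ennreal (norm (f z))) + var \<sigma> f"

definition BV :: "complex set \<Rightarrow> (complex \<Rightarrow> complex) set" where
  "BV \<sigma> = {f. (\<forall>z. z \<notin> \<sigma> \<longrightarrow> f z = 0) \<and> eBV_norm \<sigma> f < \<infinity>}"

definition BV_norm :: "complex set \<Rightarrow> (complex \<Rightarrow> complex) \<Rightarrow> real" where
  "BV_norm \<sigma> f = enn2real (eBV_norm \<sigma> f)"

text \<open>A normed algebra of functions is a pair \<open>(A, N)\<close> of a carrier and a norm; its operations are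
  the pointwise ones.\<close>

type_synonym fun_alg = "(complex \<Rightarrow> complex) set \<times> ((complex \<Rightarrow> complex) \<Rightarrow> real)"

definition norm_topology :: "fun_alg \<Rightarrow> (complex \<Rightarrow> complex) topology" where
  "norm_topology X = Metric_space.mtopology (fst X) (\<lambda>f g. snd X (\<lambda>z. f z - g z))"

definition poly_restrictions :: "complex set \<Rightarrow> (complex \<Rightarrow> complex) set" where
  "poly_restrictions \<sigma> =
     {f. \<exists>(c :: nat \<Rightarrow> nat \<Rightarrow> complex) N. f = (\<lambda>z. if z \<in> \<sigma>
        then \<Sum>n\<le>N. \<Sum>m\<le>N. c n m * of_real (Re z) ^ n * of_real (Im z) ^ m else 0)}"

definition AC :: "complex set \<Rightarrow> (complex \<Rightarrow> complex) set" where
  "AC \<sigma> = norm_topology (BV \<sigma>, BV_norm \<sigma>) closure_of poly_restrictions \<sigma>"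

definition AC_alg :: "complex set \<Rightarrow> fun_alg" where
  "AC_alg \<sigma> = (AC \<sigma>, BV_norm \<sigma>)"

definition banach_alg_iso :: "fun_alg \<Rightarrow> fun_alg \<Rightarrow> bool" where
  "banach_alg_iso X Y \<longleftrightarrow>
     (\<exists>\<Phi>. bij_betw \<Phi> (fst X) (fst Y) \<and>
       (\<forall>f\<in>fst X. \<forall>g\<in>fst X. \<Phi> (\<lambda>z. f z + g z) = (\<lambda>z. \<Phi> f z + \<Phi> g z)) \<and>
       (\<forall>a. \<forall>f\<in>fst X. \<Phi> (\<lambda>z. a * f z) = (\<lambda>z. a * \<Phi> f z)) \<and>
       (\<forall>f\<in>fst X. \<forall>g\<in>fst X. \<Phi> (\<lambda>z. f z * g z) = (\<lambda>z. \<Phi> f z * \<Phi> g z)) \<and>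
       continuous_map (norm_topology X) (norm_topology Y) \<Phi> \<and>
       continuous_map (norm_topology Y) (norm_topology X) (inv_into (fst X) \<Phi>))"

definition C_set :: "complex set \<Rightarrow> bool" where
  "C_set \<sigma> \<longleftrightarrow> countable \<sigma> \<and> infinite \<sigma> \<and> compact \<sigma> \<and> (\<forall>z. z islimpt \<sigma> \<longleftrightarrow> z = 0)"

definition real_C_set :: "complex set \<Rightarrow> bool" where
  "real_C_set \<sigma> \<longleftrightarrow> C_set \<sigma> \<and> \<sigma> \<subseteq> \<real>"

definition real_AC_algs :: "fun_alg set" where
  "real_AC_algs = {AC_alg \<sigma> |\<sigma>. real_C_set \<sigma>}"

definition iso_rel :: "(fun_alg \<times> fun_alg) set" where
  "iso_rel = {(X, Y). X \<in> real_AC_algs \<and> Y \<in> real_AC_algs \<and> banach_alg_iso X Y}"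

text \<open>\<^const>\<open>BV_norm\<close> induces a metric, so that \<^const>\<open>norm_topology\<close> is the expected
  topology on \<^const>\<open>BV\<close> and on \<^const>\<open>AC\<close>.\<close>

lemma cvar_nonneg: "0 \<le> cvar f S"
  by (simp add: cvar_def sum_nonneg)

lemma cvar_triangle: "cvar (\<lambda>z. f z - h z) S \<le> cvar (\<lambda>z. f z - g z) S + cvar (\<lambda>z. g z - h z) S"
  unfolding cvar_def sum.distrib[symmetric]
proof (rule sum_mono)
  fix i
  show "norm (f (S ! (i + 1)) - h (S ! (i + 1)) - (f (S ! i) - h (S ! i)))
      \<le> norm (f (S ! (i + 1)) - g (S ! (i + 1)) - (f (S ! i) - g (S ! i))) +
        norm (g (S ! (i + 1)) - h (S ! (i + 1)) - (g (S ! i) - h (S ! i)))"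
    using norm_triangle_ineq[of "f (S ! (i + 1)) - g (S ! (i + 1)) - (f (S ! i) - g (S ! i))"
        "g (S ! (i + 1)) - h (S ! (i + 1)) - (g (S ! i) - h (S ! i))"]
    by (simp add: algebra_simps)
qed

lemma eBV_norm_triangle:
  "eBV_norm \<sigma> (\<lambda>z. f z - h z) \<le> eBV_norm \<sigma> (\<lambda>z. f z - g z) + eBV_norm \<sigma> (\<lambda>z. g z - h z)"
proof -
  have 1: "(SUP z\<in>\<sigma>. ennreal (norm (f z - h z))) \<le>
      (SUP z\<in>\<sigma>. ennreal (norm (f z - g z))) + (SUP z\<in>\<sigma>. ennreal (norm (g z - h z)))"
  proof (rule SUP_least)
    fix z assume z: "z \<in> \<sigma>"
    have "norm (f z - h z) \<le> norm (f z - g z) + norm (g z - h z)"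
      using norm_triangle_ineq[of "f z - g z" "g z - h z"] by simp
    then have "ennreal (norm (f z - h z)) \<le> ennreal (norm (f z - g z)) + ennreal (norm (g z - h z))"
      by (simp flip: ennreal_plus add: ennreal_leI)
    also have "\<dots> \<le> (SUP z\<in>\<sigma>. ennreal (norm (f z - g z))) + (SUP z\<in>\<sigma>. ennreal (norm (g z - h z)))"
      using z by (intro add_mono SUP_upper)
    finally show "ennreal (norm (f z - h z)) \<le> \<dots>" .
  qed
  have 2: "var \<sigma> (\<lambda>z. f z - h z) \<le> var \<sigma> (\<lambda>z. f z - g z) + var \<sigma> (\<lambda>z. g z - h z)"
    unfolding var_def
  proof (rule SUP_least)
    let ?A = "{S. S \<noteq> [] \<and> set S \<subseteq> \<sigma>}"
    fix S assume S: "S \<in> ?A"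
    have "cvar (\<lambda>z. f z - h z) S / vf S \<le>
        cvar (\<lambda>z. f z - g z) S / vf S + cvar (\<lambda>z. g z - h z) S / vf S"
      using cvar_triangle[of f h S g] by (simp flip: add_divide_distrib add: divide_right_mono)
    then have "ennreal (cvar (\<lambda>z. f z - h z) S / vf S) \<le>
        ennreal (cvar (\<lambda>z. f z - g z) S / vf S) + ennreal (cvar (\<lambda>z. g z - h z) S / vf S)"
      by (simp flip: ennreal_plus add: ennreal_leI cvar_nonneg)
    also have "\<dots> \<le> (SUP S\<in>?A. ennreal (cvar (\<lambda>z. f z - g z) S / vf S)) +
        (SUP S\<in>?A. ennreal (cvar (\<lambda>z. g z - h z) S / vf S))"
      using S by (intro add_mono SUP_upper)
    finally show "ennreal (cvar (\<lambda>z. f z - h z) S / vf S) \<le> \<dots>" .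
  qed
  show ?thesis
    unfolding eBV_norm_def using add_mono[OF 1 2] by (simp add: ac_simps)
qed

lemma eBV_norm_commute: "eBV_norm \<sigma> (\<lambda>z. f z - g z) = eBV_norm \<sigma> (\<lambda>z. g z - f z)"
proof -
  have 1: "norm (f x - g x - (f y - g y)) = norm (g x - f x - (g y - f y))" for x y
    using norm_minus_cancel[of "f x - g x - (f y - g y)"] by (simp add: algebra_simps)
  have "cvar (\<lambda>z. f z - g z) S = cvar (\<lambda>z. g z - f z) S" for S
    unfolding cvar_def by (intro sum.cong refl 1)
  then show ?thesis
    unfolding eBV_norm_def var_def by (simp add: norm_minus_commute[of "f _"])
qed

lemma eBV_norm_zero: "eBV_norm \<sigma> (\<lambda>z. 0) = 0"
proof -
  have "(SUP z\<in>\<sigma>. ennreal (norm (0::complex))) \<le> 0"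
    by (rule SUP_least) simp
  moreover have "var \<sigma> (\<lambda>z. 0) \<le> 0"
    unfolding var_def by (rule SUP_least) (simp add: cvar_def)
  ultimately show ?thesis by (simp add: eBV_norm_def)
qed

lemma eBV_norm_ge: "z \<in> \<sigma> \<Longrightarrow> ennreal (norm (f z)) \<le> eBV_norm \<sigma> f"
  unfolding eBV_norm_def
  by (rule order_trans[OF SUP_upper[of z \<sigma> "\<lambda>z. ennreal (norm (f z))"]]) simp_all

lemma BV_diff_finite:
  assumes "f \<in> BV \<sigma>" "g \<in> BV \<sigma>"
  shows "eBV_norm \<sigma> (\<lambda>z. f z - g z) < \<infinity>"
proof -
  have "eBV_norm \<sigma> (\<lambda>z. f z - g z) \<le> eBV_norm \<sigma> (\<lambda>z. f z - 0) + eBV_norm \<sigma> (\<lambda>z. 0 - g z)"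
    by (rule eBV_norm_triangle[of \<sigma> f g "\<lambda>z. 0"])
  also have "\<dots> = eBV_norm \<sigma> f + eBV_norm \<sigma> g"
    using eBV_norm_commute[of \<sigma> g "\<lambda>z. 0"] by simp
  also have "\<dots> < \<infinity>" using assms by (simp add: BV_def)
  finally show ?thesis .
qed

lemma Metric_space_BV: "Metric_space (BV \<sigma>) (\<lambda>f g. BV_norm \<sigma> (\<lambda>z. f z - g z))"
proof
  fix f g
  show "0 \<le> BV_norm \<sigma> (\<lambda>z. f z - g z)" by (simp add: BV_norm_def)
  show "BV_norm \<sigma> (\<lambda>z. f z - g z) = BV_norm \<sigma> (\<lambda>z. g z - f z)"
    unfolding BV_norm_def by (subst eBV_norm_commute) (rule refl)
next
  fix f g assume fg: "f \<in> BV \<sigma>" "g \<in> BV \<sigma>"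
  show "BV_norm \<sigma> (\<lambda>z. f z - g z) = 0 \<longleftrightarrow> f = g"
  proof
    assume "BV_norm \<sigma> (\<lambda>z. f z - g z) = 0"
    with BV_diff_finite[OF fg] have 0: "eBV_norm \<sigma> (\<lambda>z. f z - g z) = 0"
      by (auto simp: BV_norm_def enn2real_eq_0_iff)
    show "f = g"
    proof
      fix z
      show "f z = g z"
      proof (cases "z \<in> \<sigma>")
        case True
        then show ?thesis using eBV_norm_ge[of z \<sigma> "\<lambda>z. f z - g z"] 0
          by (simp add: ennreal_eq_0_iff)
      qed (use fg in \<open>auto simp: BV_def\<close>)
    qed
  qed (simp add: BV_norm_def eBV_norm_zero)
next
  fix f g h assume "f \<in> BV \<sigma>" "g \<in> BV \<sigma>" "h \<in> BV \<sigma>"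
  then have fin: "eBV_norm \<sigma> (\<lambda>z. f z - g z) < \<infinity>" "eBV_norm \<sigma> (\<lambda>z. g z - h z) < \<infinity>"
    by (blast intro: BV_diff_finite)+
  show "BV_norm \<sigma> (\<lambda>z. f z - h z) \<le> BV_norm \<sigma> (\<lambda>z. f z - g z) + BV_norm \<sigma> (\<lambda>z. g z - h z)"
    unfolding BV_norm_def
    using fin eBV_norm_triangle[of \<sigma> f h g]
    by (simp flip: enn2real_plus add: enn2real_mono)
qed

lemma AC_subset_BV: "AC \<sigma> \<subseteq> BV \<sigma>"
proof -
  interpret Metric_space "BV \<sigma>" "\<lambda>f g. BV_norm \<sigma> (\<lambda>z. f z - g z)"
    by (rule Metric_space_BV)
  show ?thesis
    unfolding AC_def norm_topology_def fst_conv snd_conv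
    using closure_of_subset_topspace[of mtopology] by (simp only: topspace_mtopology)
qed

lemma Metric_space_AC: "Metric_space (AC \<sigma>) (\<lambda>f g. BV_norm \<sigma> (\<lambda>z. f z - g z))"
  by (rule Metric_space.subspace[OF Metric_space_BV AC_subset_BV])

end

theory Submission
  imports Defs
begin

text \<open>
  On a subset of the real line the variation factor is a bookkeeping device only: \<^const>\<open>var\<close>
  is the classical variation.  A strictly increasing list crosses each line at most once, so it has
  factor 1; conversely, a list that runs back and forth over the gap between two consecutive
  points crosses a line through that gap each time, so its factor pays for the repetitions.
  For a real \<open>C\<close>-set this makes \<open>AC\<close> the closure, in the supremum norm plus classical
  variation, of the functions that are constant near \<open>0\<close>
  (\<open>AC_eq_bv_closure\<close>).  The two inclusions come from the bumps
  \<open>(1 - ((x - a) / R)\<^sup>2) ^ n\<close>, which converge in variation to the indicator of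
  the isolated point \<open>a\<close>, and from cutting the coordinate function off near \<open>0\<close>.

  Call a set two-sided if it accumulates at \<open>0\<close> from both sides, and one-sided otherwise.  The
  composition \<open>f \<mapsto> f \<circ> h\<close> with a bijection \<open>h\<close> fixing \<open>0\<close> is an isomorphism as soon as \<open>h\<close> is
  monotone off a finite set, because each exceptional point costs a multiple of the supremum norm at
  most (\<open>banach_alg_iso_reparametrize\<close>).  Two two-sided sets are even order isomorphic.
  Two one-sided sets, each enumerated with its finitely many points on the wrong side first and then
  its other points towards \<open>0\<close>, are matched by a bijection that is monotone off finitely many points.
  Hence there are at most two classes.

  The two kinds are not isomorphic (\<open>two_sided_not_iso_one_sided\<close>).  The minimal idempotents
  of \<open>AC\<close> are the indicators of the isolated points, so an isomorphism from a two-sided to a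
  one-sided set carries isolated points to isolated points.  The indicators of
  \<open>{x. r \<le> x}\<close>, \<open>r > 0\<close>, have variation at most 1 in the two-sided set.  The images of the two
  halves, however, both accumulate at \<open>0\<close> from the same side; they alternate infinitely often there,
  and the images of those indicators have unbounded variation.
\<close>

section \<open>Variation on the real line\<close>

text \<open>The sign \<open>s\<close> is 1 for increasing and \<open>-1\<close> for decreasing lists; treating both at once covers
  sets that accumulate at \<open>0\<close> from the right and from the left.\<close>

definition directed_list :: "real \<Rightarrow> complex list \<Rightarrow> bool" where
  "directed_list s T \<longleftrightarrow> sorted_wrt (\<lambda>x y. s * Re x < s * Re y) T"

lemma cvar_simps [simp]:
  "cvar f [] = 0"
  "cvar f [x] = 0"
  "cvar f (x # y # T) = norm (f y - f x) + cvar f (y # T)"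
  by (simp_all add: cvar_def sum.lessThan_Suc_shift del: sum.lessThan_Suc)

text \<open>A line meets the real axis in at most one point or contains it.  In the second case only the
  first segment counts as crossing.  In the first, two crossing segments would each touch the line,
  and the half-open counting rule attributes the common point to one of them only.\<close>

lemma vf_increasing:
  assumes inc: "directed_list 1 T" and real: "set T \<subseteq> \<real>" and ne: "T \<noteq> []"
  shows "vf T = 1"
proof -
  define n where "n = length T - 1"
  have less: "Re (T ! i) < Re (T ! j)" if "i < j" "j \<le> n" for i j
    using sorted_wrt_nth_less[OF inc[unfolded directed_list_def], of i j] that ne
    by (cases T) (auto simp: n_def)
  have inR: "T ! i \<in> \<real>" if "i \<le> n" for i
    using real that ne nth_mem[of i T] by (cases T) (auto simp: n_def)
  have "vf_line T L \<le> 1" if L: "plane_line L" for L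
  proof (cases "\<real> \<subseteq> L")
    case True
    have "i = 0" if "i < n" "crossing_segment T L i" for i
    proof -
      have "T ! i \<in> L" "T ! (i - 1) \<in> L" using True inR[of i] inR[of "i - 1"] that by auto
      then show ?thesis using that by (auto simp: crossing_segment_def opposite_sides_def)
    qed
    then have "{i. i < n \<and> crossing_segment T L i} \<subseteq> {0}" by auto
    then show ?thesis unfolding vf_line_def n_def[symmetric]
      using card_mono[of "{0::nat}"] by fastforce
  next
    case False
    obtain u c where uc: "L = {z. inner u z = c}" using L by (auto simp: plane_line_def)
    have inner_real: "inner v z = Re v * Re z" if "z \<in> \<real>" for v z :: complex
      using that by (auto simp: complex_is_Real_iff inner_complex_def)
    have unique: "p = q" if "p \<in> L" "q \<in> L" "p \<in> \<real>" "q \<in> \<real>" for p q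
    proof (rule ccontr)
      assume "p \<noteq> q"
      then have "Re p \<noteq> Re q" using that by (auto simp: complex_is_Real_iff complex_eq_iff)
      moreover have "Re u * Re p = c" "Re u * Re q = c" using that by (auto simp: uc inner_real)
      ultimately have "Re u = 0" "c = 0" by auto
      then have "\<real> \<subseteq> L" by (auto simp: uc inner_real)
      then show False using False by simp
    qed
    have opp: "\<exists>p. p \<in> L \<and> p \<in> \<real> \<and> Re (T ! i) \<le> Re p \<and> Re p < Re (T ! (i + 1))"
      if i: "i < n" and opp: "opposite_sides L (T ! i) (T ! (i + 1))" for i
    proof -
      obtain v d where vd: "L = {z. inner v z = d}" "inner v (T ! i) < d" "d < inner v (T ! (i + 1))"
        using opp by (auto simp: opposite_sides_def)
      then have *: "Re v * Re (T ! i) < d" "d < Re v * Re (T ! (i + 1))"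
        using inR[of i] inR[of "i + 1"] i by (auto simp: inner_real)
      have "Re (T ! i) < Re (T ! (i + 1))" using less i by simp
      then have pos: "Re v > 0"
        using * mult_left_mono_neg[of "Re (T ! i)" "Re (T ! (i + 1))" "Re v"] by force
      have "of_real (d / Re v) \<in> L" using pos by (simp add: vd inner_real)
      then show ?thesis using * pos
        by (intro exI[of _ "of_real (d / Re v)"]) (auto simp: field_simps)
    qed
    \<comment> \<open>a crossing segment other than the last one meets the line before its right end point\<close>
    have early: "\<exists>p. p \<in> L \<and> p \<in> \<real> \<and> Re (T ! i) \<le> Re p \<and> Re p < Re (T ! (i + 1))"
      if "i + 1 < n" "crossing_segment T L i" for i
      using that opp[of i] inR[of i] less[of i "i + 1"]
      unfolding crossing_segment_def n_def[symmetric] by force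
    have late: "\<exists>p. p \<in> L \<and> p \<in> \<real> \<and> Re (T ! i) \<le> Re p"
      if "i < n" "crossing_segment T L i" for i
      using that opp[of i] inR[of i] inR[of "i + 1"] less[of i "i + 1"]
      unfolding crossing_segment_def n_def[symmetric] by force
    have no_pair: False
      if that: "i < j" "j < n" "crossing_segment T L i" "crossing_segment T L j" for i j
    proof -
      have "i + 1 < n" using that by simp
      then obtain p where p: "p \<in> L" "p \<in> \<real>" "Re p < Re (T ! (i + 1))"
        using early[of i] \<open>crossing_segment T L i\<close> by blast
      obtain q where q: "q \<in> L" "q \<in> \<real>" "Re (T ! j) \<le> Re q" using late[of j] \<open>j < n\<close> \<open>crossing_segment T L j\<close> by blast
      have "Re (T ! (i + 1)) \<le> Re (T ! j)" 
        using less[of "i + 1" j] that by (cases "i + 1 = j") auto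
      then show False using unique[of p q] p q by auto
    qed
    have "i = j"
      if "i \<in> {i. i < n \<and> crossing_segment T L i}" "j \<in> {i. i < n \<and> crossing_segment T L i}" for i j
      using that no_pair[of i j] no_pair[of j i] by (cases i j rule: linorder_cases) auto
    then show ?thesis unfolding vf_line_def n_def[symmetric]
      by (simp add: card_le_Suc0_iff_eq)
  qed
  moreover have "plane_line {z. inner 1 z = 0}"
    unfolding plane_line_def by (intro exI[of _ 1] exI[of _ 0]) simp
  ultimately have "vf T \<le> 1"
    unfolding vf_def by (auto intro!: Max.boundedI finite_vf_line_image)
  with vf_pos[OF ne] show ?thesis by simp
qed

lemma norm_diff_le_sum_steps:
  fixes F :: "nat \<Rightarrow> 'a::real_normed_vector"
  assumes "a \<le> b"
  shows "norm (F b - F a) \<le> (\<Sum>g\<in>{a..<b}. norm (F (g + 1) - F g))"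
proof -
  have "F b - F a = (\<Sum>g\<in>{a..<b}. F (Suc g) - F g)" using assms by (rule sum_Suc_diff'[symmetric])
  then show ?thesis by (simp add: norm_sum)
qed

text \<open>Refine every step of \<open>S\<close> to the consecutive gaps of the sorted list \<open>T\<close> of its points and
  exchange the order of summation: a gap is used once for each segment of \<open>S\<close> across it, and all
  these segments cross the perpendicular line through its midpoint.\<close>

lemma cvar_le_vf_mult:
  assumes real: "\<sigma> \<subseteq> \<real>" and S: "S \<noteq> []" "set S \<subseteq> \<sigma>"
    and bd: "\<And>T. directed_list 1 T \<Longrightarrow> set T \<subseteq> \<sigma> \<Longrightarrow> cvar f T \<le> B"
  shows "cvar f S \<le> B * vf S"
proof (cases "length S = 1")
  case True
  have "cvar f [] \<le> B" by (rule bd) (auto simp: directed_list_def)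
  then show ?thesis using True by (simp add: cvar_def)
next
  case False
  define n where "n = length S - 1"
  define T where "T = map complex_of_real (sorted_list_of_set (Re ` set S))"
  have setT: "set T = set S"
  proof -
    have "complex_of_real (Re x) = x" if "x \<in> set S" for x
      using that S real by (auto simp: subset_iff)
    then show ?thesis by (force simp: T_def image_image)
  qed
  have dirT: "directed_list 1 T"
    using strict_sorted_list_of_set[of "Re ` set S"]
    by (simp add: directed_list_def T_def sorted_wrt_map)
  define m where "m = length T - 1"
  have "T \<noteq> []" using setT S by auto
  then have lenT: "length T = Suc m" by (simp add: m_def)
  have lenS: "length S = Suc n" using S by (simp add: n_def)
  have less: "Re (T ! i) < Re (T ! j)" if "i < j" "j \<le> m" for i j
    using sorted_wrt_nth_less[OF dirT[unfolded directed_list_def], of i j] that lenT by auto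
  have mono: "Re (T ! i) \<le> Re (T ! j)" if "i \<le> j" "j \<le> m" for i j
    using less[of i j] that by (cases "i = j") auto
  have "\<forall>i\<le>n. \<exists>k\<le>m. T ! k = S ! i"
    using setT lenS lenT by (metis in_set_conv_nth less_Suc_eq_le)
  then obtain k where k: "k i \<le> m" "T ! k i = S ! i" if "i \<le> n" for i by metis
  define btw where "btw i = {min (k i) (k (i + 1))..<max (k i) (k (i + 1))}" for i
  define D where "D g = norm (f (T ! (g + 1)) - f (T ! g))" for g
  have step: "norm (f (S ! (i + 1)) - f (S ! i)) \<le> (\<Sum>g<m. if g \<in> btw i then D g else 0)"
    if i: "i < n" for i
  proof -
    have "norm (f (S ! (i + 1)) - f (S ! i)) = norm (f (T ! k (i + 1)) - f (T ! k i))"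
      using k i by simp
    also have "\<dots> \<le> sum D (btw i)"
      using norm_diff_le_sum_steps[of "k i" "k (i + 1)" "\<lambda>g. f (T ! g)"]
        norm_diff_le_sum_steps[of "k (i + 1)" "k i" "\<lambda>g. f (T ! g)"]
      by (cases "k i \<le> k (i + 1)") (auto simp: btw_def D_def norm_minus_commute)
    also have "btw i = {..<m} \<inter> btw i" using k[of i] k[of "i + 1"] i by (auto simp: btw_def)
    finally show ?thesis by (simp add: sum.inter_restrict)
  qed
  have count: "card {i\<in>{..<n}. g \<in> btw i} \<le> vf S" if g: "g < m" for g
  proof -
    define c where "c = (Re (T ! g) + Re (T ! (g + 1))) / 2"
    have c: "Re (T ! g) < c" "c < Re (T ! (g + 1))" using less[of g "g + 1"] g by (auto simp: c_def)
    define L where "L = {z::complex. inner 1 z = c}"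
    have L': "L = {z. inner (-1) z = -c}" by (auto simp: L_def)
    have "crossing_segment S L i" if i: "i < n" "g \<in> btw i" for i
    proof -
      have *: "Re (S ! i) = Re (T ! k i)" "Re (S ! (i + 1)) = Re (T ! k (i + 1))" "k i \<le> m" "k (i + 1) \<le> m"
        using k[of i] k[of "i + 1"] i by auto
      have "opposite_sides L (S ! i) (S ! (i + 1))"
      proof (cases "k i \<le> k (i + 1)")
        case True
        then have "inner 1 (S ! i) < c \<and> c < inner 1 (S ! (i + 1))"
          using i mono[of "k i" g] mono[of "g + 1" "k (i + 1)"] c g *
          by (auto simp: btw_def)
        then show ?thesis unfolding opposite_sides_def
          by (intro exI[of _ 1] exI[of _ c]) (simp add: L_def)
      next
        case False
        then have "inner (-1) (S ! i) < -c \<and> -c < inner (-1) (S ! (i + 1))"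
          using i mono[of "k (i + 1)" g] mono[of "g + 1" "k i"] c g *
          by (auto simp: btw_def)
        then show ?thesis unfolding opposite_sides_def
          by (intro exI[of _ "-1"] exI[of _ "-c"]) (simp add: L')
      qed
      then show ?thesis by (simp add: crossing_segment_def)
    qed
    then have "card {i\<in>{..<n}. g \<in> btw i} \<le> vf_line S L"
      unfolding vf_line_def n_def[symmetric] by (intro card_mono) auto
    also have "plane_line L" unfolding plane_line_def L_def
      by (intro exI[of _ 1] exI[of _ c]) simp
    then have "vf_line S L \<le> vf S"
      using False unfolding vf_def by (auto intro!: Max_ge finite_vf_line_image)
    finally show ?thesis .
  qed
  have "cvar f S \<le> (\<Sum>i<n. \<Sum>g<m. if g \<in> btw i then D g else 0)"
    unfolding cvar_def n_def[symmetric] by (intro sum_mono step) auto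
  also have "\<dots> = (\<Sum>g<m. \<Sum>i<n. if g \<in> btw i then D g else 0)" by (rule sum.swap)
  also have "\<dots> = (\<Sum>g<m. card {i\<in>{..<n}. g \<in> btw i} * D g)"
    by (simp flip: sum.inter_filter)
  also have "\<dots> \<le> (\<Sum>g<m. vf S * D g)"
    by (intro sum_mono mult_right_mono) (use count in \<open>auto simp: D_def\<close>)
  also have "\<dots> = vf S * cvar f T"
    by (simp add: cvar_def D_def m_def sum_distrib_left)
  also have "\<dots> \<le> vf S * B"
    using bd[OF dirT] setT S by (intro mult_left_mono) auto
  finally show ?thesis by (simp add: mult.commute)
qed

section \<open>Bounds for the supremum norm and the variation\<close>

text \<open>A working substitute for the norm: it differs from \<^const>\<open>BV_norm\<close> by a factor of at most 2 on
  real sets, and estimates need no suprema.\<close>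

definition bv_bound :: "complex set \<Rightarrow> (complex \<Rightarrow> complex) \<Rightarrow> real \<Rightarrow> bool" where
  "bv_bound \<sigma> f B \<longleftrightarrow> (\<forall>z\<in>\<sigma>. norm (f z) \<le> B) \<and>
     (\<forall>T. directed_list 1 T \<longrightarrow> set T \<subseteq> \<sigma> \<longrightarrow> cvar f T \<le> B)"

lemma bv_boundI:
  assumes "\<And>z. z \<in> \<sigma> \<Longrightarrow> norm (f z) \<le> B"
    and "\<And>T. directed_list 1 T \<Longrightarrow> set T \<subseteq> \<sigma> \<Longrightarrow> cvar f T \<le> B"
  shows "bv_bound \<sigma> f B"
  using assms by (simp add: bv_bound_def)

lemma bv_bound_norm: "bv_bound \<sigma> f B \<Longrightarrow> z \<in> \<sigma> \<Longrightarrow> norm (f z) \<le> B"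
  by (simp add: bv_bound_def)

lemma bv_bound_nonneg: "bv_bound \<sigma> f B \<Longrightarrow> 0 \<le> B"
  by (auto simp: bv_bound_def directed_list_def dest!: spec[of _ "[]"])

lemma bv_bound_mono: "bv_bound \<sigma> f A \<Longrightarrow> A \<le> B \<Longrightarrow> bv_bound \<sigma> f B"
  by (force simp: bv_bound_def)

lemma cvar_rev: "cvar f (rev T) = cvar f T"
proof -
  define n where "n = length T - 1"
  have "cvar f (rev T) = (\<Sum>i<n. norm (f (rev T ! (i + 1)) - f (rev T ! i)))"
    by (simp add: cvar_def n_def)
  also have "\<dots> = (\<Sum>i<n. norm (f (T ! (n - Suc i)) - f (T ! (n - Suc i + 1))))"
  proof (intro sum.cong refl)
    fix i assume "i \<in> {..<n}"
    then have "rev T ! (i + 1) = T ! (n - Suc i)" "rev T ! i = T ! (n - Suc i + 1)"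
      by (auto simp: rev_nth n_def Suc_diff_Suc)
    then show "norm (f (rev T ! (i + 1)) - f (rev T ! i)) =
        norm (f (T ! (n - Suc i)) - f (T ! (n - Suc i + 1)))" by simp
  qed
  also have "\<dots> = (\<Sum>i<n. norm (f (T ! i) - f (T ! (i + 1))))"
    by (rule sum.nat_diff_reindex)
  finally show ?thesis by (simp add: cvar_def n_def norm_minus_commute)
qed

lemma directed_list_rev: "directed_list s (rev T) \<longleftrightarrow> directed_list (- s) T"
  by (simp add: directed_list_def sorted_wrt_rev)

lemma bv_bound_cvar:
  assumes "bv_bound \<sigma> f B" "directed_list s T" "s \<in> {1, -1}" "set T \<subseteq> \<sigma>"
  shows "cvar f T \<le> B"
  using assms(2-4) assms(1)[unfolded bv_bound_def, THEN conjunct2, rule_format, of T]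
    assms(1)[unfolded bv_bound_def, THEN conjunct2, rule_format, of "rev T"]
    cvar_rev[of f T] directed_list_rev[of 1 T] by auto

lemma bv_boundI_directed:
  assumes "s \<in> {1, -1}" "\<And>z. z \<in> \<sigma> \<Longrightarrow> norm (f z) \<le> B"
    and "\<And>T. directed_list s T \<Longrightarrow> set T \<subseteq> \<sigma> \<Longrightarrow> cvar f T \<le> B"
  shows "bv_bound \<sigma> f B"
proof (rule bv_boundI)
  fix T assume "directed_list 1 T" "set T \<subseteq> \<sigma>"
  then show "cvar f T \<le> B"
    using assms(1) assms(3)[of T] assms(3)[of "rev T"] cvar_rev[of f T] directed_list_rev[of "-1" T] 
    by auto
qed (use assms in auto)

text \<open>If the increments of \<open>f\<close> are dominated by those of a real function \<open>m\<close>, the sum telescopes.  All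
  concrete functions below have their variation estimated by an explicit majorant.\<close>

lemma cvar_le_majorant:
  assumes inc: "\<And>x y. x \<in> \<sigma> \<Longrightarrow> y \<in> \<sigma> \<Longrightarrow> Re x < Re y \<Longrightarrow> norm (f y - f x) \<le> m y - m x"
    and "directed_list 1 T" "set T \<subseteq> \<sigma>" "T \<noteq> []"
  shows "cvar f T \<le> m (last T) - m (hd T)"
  using assms(2-)
proof (induction T rule: induct_list012)
  case (3 x y T)
  then show ?case using inc[of x y] by (force simp: directed_list_def)
qed (auto simp: directed_list_def)

lemma bv_bound_majorant:
  assumes "\<And>z. z \<in> \<sigma> \<Longrightarrow> norm (f z) \<le> B"
    and "\<And>x y. x \<in> \<sigma> \<Longrightarrow> y \<in> \<sigma> \<Longrightarrow> Re x < Re y \<Longrightarrow> norm (f y - f x) \<le> m y - m x"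
    and "\<And>z. z \<in> \<sigma> \<Longrightarrow> 0 \<le> m z \<and> m z \<le> B" and "0 \<le> B"
  shows "bv_bound \<sigma> f B"
proof (rule bv_boundI)
  fix T assume T: "directed_list 1 T" "set T \<subseteq> \<sigma>"
  show "cvar f T \<le> B"
  proof (cases "T = []")
    case False
    then have "last T \<in> \<sigma>" "hd T \<in> \<sigma>" using T by (auto simp: subset_iff)
    then have "m (last T) \<le> B" "0 \<le> m (hd T)" using assms(3) by auto
    moreover have "cvar f T \<le> m (last T) - m (hd T)"
      using assms(2) T False by (rule cvar_le_majorant)
    ultimately show ?thesis by linarith
  qed (use assms in auto)
qed (use assms in auto)

lemma cvar_add: "cvar (\<lambda>z. f z + g z) T \<le> cvar f T + cvar g T"
  unfolding cvar_def sum.distrib[symmetric]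
  by (intro sum_mono) (metis add_diff_add norm_triangle_ineq)

lemma cvar_scale: "cvar (\<lambda>z. a * f z) T = norm a * cvar f T"
  by (simp add: cvar_def sum_distrib_left flip: norm_mult right_diff_distrib)

lemma cvar_mult:
  assumes "\<And>z. z \<in> set T \<Longrightarrow> norm (f z) \<le> A" "\<And>z. z \<in> set T \<Longrightarrow> norm (g z) \<le> B"
  shows "cvar (\<lambda>z. f z * g z) T \<le> A * cvar g T + B * cvar f T"
  unfolding cvar_def sum.distrib[symmetric] sum_distrib_left
proof (rule sum_mono)
  fix i assume "i \<in> {..<length T - 1}"
  then have mem: "T ! i \<in> set T" "T ! (i + 1) \<in> set T" by auto
  have eq: "f (T ! (i + 1)) * g (T ! (i + 1)) - f (T ! i) * g (T ! i) =
      f (T ! (i + 1)) * (g (T ! (i + 1)) - g (T ! i)) + g (T ! i) * (f (T ! (i + 1)) - f (T ! i))"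
    by (simp add: algebra_simps)
  show "norm (f (T ! (i + 1)) * g (T ! (i + 1)) - f (T ! i) * g (T ! i)) \<le>
      A * norm (g (T ! (i + 1)) - g (T ! i)) + B * norm (f (T ! (i + 1)) - f (T ! i))"
    unfolding eq using assms mem
    by (intro order_trans[OF norm_triangle_ineq]) (auto simp: norm_mult intro!: add_mono mult_right_mono)
qed

lemma bv_bound_add: "bv_bound \<sigma> f A \<Longrightarrow> bv_bound \<sigma> g B \<Longrightarrow> bv_bound \<sigma> (\<lambda>z. f z + g z) (A + B)"
  by (rule bv_boundI)
    (simp_all add: bv_bound_def norm_triangle_mono order_trans[OF cvar_add add_mono])

lemma bv_bound_scale: "bv_bound \<sigma> f A \<Longrightarrow> bv_bound \<sigma> (\<lambda>z. a * f z) (norm a * A)"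
  by (auto simp: bv_bound_def cvar_scale norm_mult mult_left_mono)

lemma bv_bound_mult:
  assumes f: "bv_bound \<sigma> f A" and g: "bv_bound \<sigma> g B"
  shows "bv_bound \<sigma> (\<lambda>z. f z * g z) (2 * A * B)"
proof (rule bv_boundI)
  have pos: "0 \<le> A" "0 \<le> B" using f g by (auto dest: bv_bound_nonneg)
  { fix z assume "z \<in> \<sigma>"
    then have "norm (f z * g z) \<le> A * B"
      using f g pos by (auto simp: norm_mult bv_bound_def intro!: mult_mono)
    moreover have "0 \<le> A * B" using pos by simp
    ultimately show "norm (f z * g z) \<le> 2 * A * B" by linarith }
  fix T assume T: "directed_list 1 T" "set T \<subseteq> \<sigma>"
  have "cvar (\<lambda>z. f z * g z) T \<le> A * cvar g T + B * cvar f T"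
    by (rule cvar_mult) (use f g T in \<open>auto simp: bv_bound_def\<close>)
  also have "\<dots> \<le> A * B + B * A"
    using f g T pos by (intro add_mono mult_left_mono) (auto simp: bv_bound_def)
  finally show "cvar (\<lambda>z. f z * g z) T \<le> 2 * A * B" by simp
qed

lemma bv_bound_cong: "(\<And>z. z \<in> \<sigma> \<Longrightarrow> f z = g z) \<Longrightarrow> bv_bound \<sigma> f B \<Longrightarrow> bv_bound \<sigma> g B"
proof (rule bv_boundI)
  fix T assume eq: "\<And>z. z \<in> \<sigma> \<Longrightarrow> f z = g z" and B: "bv_bound \<sigma> f B" and T: "directed_list 1 T" "set T \<subseteq> \<sigma>"
  have "cvar f T = cvar g T"
    unfolding cvar_def by (intro sum.cong refl) (use T(2) eq in \<open>auto simp: subset_iff\<close>)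
  then show "cvar g T \<le> B" using B T by (auto simp: bv_bound_def)
qed (auto simp: bv_bound_def)

lemma eBV_norm_le:
  assumes real: "\<sigma> \<subseteq> \<real>" and B: "bv_bound \<sigma> f B"
  shows "eBV_norm \<sigma> f \<le> ennreal (2 * B)"
proof -
  have "(SUP z\<in>\<sigma>. ennreal (norm (f z))) \<le> ennreal B"
    by (intro SUP_least ennreal_leI bv_bound_norm[OF B])
  moreover have "var \<sigma> f \<le> ennreal B"
    unfolding var_def
  proof (intro SUP_least ennreal_leI)
    fix S assume S: "S \<in> {S. S \<noteq> [] \<and> set S \<subseteq> \<sigma>}"
    then have "cvar f S \<le> B * vf S" using B by (intro cvar_le_vf_mult[OF real]) (auto simp: bv_bound_def)
    then show "cvar f S / vf S \<le> B" using vf_pos[of S] S by (simp add: divide_le_eq)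
  qed
  ultimately have "eBV_norm \<sigma> f \<le> ennreal B + ennreal B"
    unfolding eBV_norm_def by (rule add_mono)
  then show ?thesis using bv_bound_nonneg[OF B] by (simp flip: ennreal_plus)
qed

lemma bv_bound_BV_norm:
  assumes real: "\<sigma> \<subseteq> \<real>" and f: "f \<in> BV \<sigma>"
  shows "bv_bound \<sigma> f (BV_norm \<sigma> f)"
proof (rule bv_boundI)
  have fin: "eBV_norm \<sigma> f < \<infinity>" using f by (simp add: BV_def)
  have le: "c \<le> BV_norm \<sigma> f" if "ennreal c \<le> eBV_norm \<sigma> f" "0 \<le> c" for c
    using enn2real_mono[OF that(1)] fin that by (simp add: BV_norm_def)
  show "norm (f z) \<le> BV_norm \<sigma> f" if "z \<in> \<sigma>" for z
    using eBV_norm_ge[OF that] by (intro le) auto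
  fix T assume T: "directed_list 1 T" "set T \<subseteq> \<sigma>"
  show "cvar f T \<le> BV_norm \<sigma> f"
  proof (cases "T = []")
    case False
    have "ennreal (cvar f T) = ennreal (cvar f T / vf T)"
      using vf_increasing[OF T(1) _ False] T(2) real by simp
    also have "\<dots> \<le> var \<sigma> f"
      unfolding var_def using T(2) False by (intro SUP_upper) simp
    also have "\<dots> \<le> eBV_norm \<sigma> f" by (simp add: eBV_norm_def)
    finally show ?thesis by (intro le cvar_nonneg)
  qed (simp add: BV_norm_def)
qed

lemma BV_norm_le:
  assumes "\<sigma> \<subseteq> \<real>" "bv_bound \<sigma> f B"
  shows "BV_norm \<sigma> f \<le> 2 * B"
  using enn2real_mono[OF eBV_norm_le[OF assms]] bv_bound_nonneg[OF assms(2)]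
  by (simp add: BV_norm_def)

lemma BV_iff:
  assumes "\<sigma> \<subseteq> \<real>"
  shows "f \<in> BV \<sigma> \<longleftrightarrow> (\<forall>z. z \<notin> \<sigma> \<longrightarrow> f z = 0) \<and> (\<exists>B. bv_bound \<sigma> f B)"
  using bv_bound_BV_norm[OF assms, of f] order_le_less_trans[OF eBV_norm_le[OF assms, of f] ennreal_less_top]
  by (auto simp: BV_def)

section \<open>Real C-sets\<close>

lemma real_C_set_zero_mem: "real_C_set \<sigma> \<Longrightarrow> 0 \<in> \<sigma>"
  unfolding real_C_set_def C_set_def using compact_imp_closed closed_limpt by blast

lemma real_C_set_subset_Reals: "real_C_set \<sigma> \<Longrightarrow> \<sigma> \<subseteq> \<real>"
  by (simp add: real_C_set_def)

text \<open>Infinitely many points off a neighbourhood of \<open>0\<close> would accumulate at a nonzero point of the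
  compact set.\<close>

lemma real_C_set_finite_away:
  assumes \<sigma>: "real_C_set \<sigma>" and e: "e > 0"
  shows "finite {z\<in>\<sigma>. e \<le> norm z}"
proof (rule ccontr)
  assume inf: "infinite {z\<in>\<sigma>. e \<le> norm z}"
  have "compact \<sigma>" and lim: "\<And>z. z islimpt \<sigma> \<longleftrightarrow> z = 0"
    using \<sigma> by (auto simp: real_C_set_def C_set_def)
  moreover have "{z\<in>\<sigma>. e \<le> norm z} = \<sigma> \<inter> {z. e \<le> norm z}" by auto
  moreover have "closed {z::complex. e \<le> norm z}" by (intro closed_Collect_le continuous_intros)
  ultimately have "compact {z\<in>\<sigma>. e \<le> norm z}" by (simp add: compact_Int_closed)
  then obtain z where z: "z \<in> {z\<in>\<sigma>. e \<le> norm z}" "z islimpt {z\<in>\<sigma>. e \<le> norm z}"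
    using inf unfolding compact_eq_Bolzano_Weierstrass by blast
  then have "z islimpt \<sigma>" using islimpt_subset[of z "{z\<in>\<sigma>. e \<le> norm z}" \<sigma>] by auto
  then show False using lim z(1) e by auto
qed

lemma real_C_set_isolated:
  assumes "real_C_set \<sigma>" "a \<noteq> 0"
  obtains e where "e > 0" "\<And>x. x \<in> \<sigma> \<Longrightarrow> x \<noteq> a \<Longrightarrow> e \<le> norm (x - a)"
proof -
  have "\<not> a islimpt \<sigma>" using assms by (simp add: real_C_set_def C_set_def)
  then show ?thesis using that unfolding islimpt_approachable dist_norm by (meson not_less)
qed

lemma Re_less_trichotomy:
  assumes "x \<in> \<real>" "y \<in> \<real>" "x \<noteq> y"
  shows "Re x < Re y \<or> Re y < Re x"
  using assms by (auto simp: complex_is_Real_iff complex_eq_iff)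

section \<open>Closure in variation norm\<close>

definition bv_closure :: "complex set \<Rightarrow> (complex \<Rightarrow> complex) set \<Rightarrow> (complex \<Rightarrow> complex) set" where
  "bv_closure \<sigma> G = {f. (\<forall>z. z \<notin> \<sigma> \<longrightarrow> f z = 0) \<and> (\<forall>\<epsilon>>0. \<exists>g\<in>G. bv_bound \<sigma> (\<lambda>z. f z - g z) \<epsilon>)}"

lemma bv_bound_zero: "0 \<le> B \<Longrightarrow> bv_bound \<sigma> (\<lambda>z. 0) B"
  by (simp add: bv_bound_def cvar_def)

lemma bv_closure_superset:
  assumes "\<And>g z. g \<in> G \<Longrightarrow> z \<notin> \<sigma> \<Longrightarrow> g z = 0"
  shows "G \<subseteq> bv_closure \<sigma> G"
proof
  fix g assume g: "g \<in> G"
  then have "\<exists>g'\<in>G. bv_bound \<sigma> (\<lambda>z. g z - g' z) \<epsilon>" if "\<epsilon> > 0" for \<epsilon>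
    using that bv_bound_zero[of \<epsilon> \<sigma>] by (intro bexI[of _ g]) auto
  with assms[OF g] show "g \<in> bv_closure \<sigma> G" by (simp add: bv_closure_def)
qed

lemma bv_closure_least:
  assumes "H \<subseteq> bv_closure \<sigma> G"
  shows "bv_closure \<sigma> H \<subseteq> bv_closure \<sigma> G"
proof
  fix f assume f: "f \<in> bv_closure \<sigma> H"
  have "\<exists>g\<in>G. bv_bound \<sigma> (\<lambda>z. f z - g z) \<epsilon>" if "\<epsilon> > 0" for \<epsilon>
  proof -
    obtain h where h: "h \<in> H" "bv_bound \<sigma> (\<lambda>z. f z - h z) (\<epsilon> / 2)"
      using f \<open>\<epsilon> > 0\<close> by (auto simp: bv_closure_def dest!: spec[of _ "\<epsilon> / 2"])
    then obtain g where g: "g \<in> G" "bv_bound \<sigma> (\<lambda>z. h z - g z) (\<epsilon> / 2)"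
      using subsetD[OF assms h(1)] \<open>\<epsilon> > 0\<close> by (auto simp: bv_closure_def dest!: spec[of _ "\<epsilon> / 2"])
    show ?thesis using g bv_bound_add[OF h(2) g(2)] by auto
  qed
  then show "f \<in> bv_closure \<sigma> G" using f by (auto simp: bv_closure_def)
qed

lemma bv_closure_bounded:
  assumes "f \<in> bv_closure \<sigma> G" "\<And>g. g \<in> G \<Longrightarrow> \<exists>B. bv_bound \<sigma> g B"
  shows "\<exists>B. bv_bound \<sigma> f B"
proof -
  obtain g where "g \<in> G" "bv_bound \<sigma> (\<lambda>z. f z - g z) 1"
    using assms(1) by (auto simp: bv_closure_def dest!: spec[of _ "1::real"])
  with assms(2)[of g] bv_bound_add[of \<sigma> "\<lambda>z. f z - g z" 1 g] show ?thesis by auto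
qed

lemma bv_closure_add:
  assumes "\<And>f g. f \<in> G \<Longrightarrow> g \<in> G \<Longrightarrow> (\<lambda>z. f z + g z) \<in> G"
    and f: "f1 \<in> bv_closure \<sigma> G" "f2 \<in> bv_closure \<sigma> G"
  shows "(\<lambda>z. f1 z + f2 z) \<in> bv_closure \<sigma> G"
proof -
  have "\<exists>g\<in>G. bv_bound \<sigma> (\<lambda>z. f1 z + f2 z - g z) \<epsilon>" if "\<epsilon> > 0" for \<epsilon>
  proof -
    obtain g1 g2 where g: "g1 \<in> G" "bv_bound \<sigma> (\<lambda>z. f1 z - g1 z) (\<epsilon> / 2)"
        "g2 \<in> G" "bv_bound \<sigma> (\<lambda>z. f2 z - g2 z) (\<epsilon> / 2)"
      using f \<open>\<epsilon> > 0\<close> by (auto simp: bv_closure_def dest!: spec[of _ "\<epsilon> / 2"])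
    show ?thesis using assms(1)[OF g(1,3)] bv_bound_add[OF g(2,4)]
      by (intro bexI[of _ "\<lambda>z. g1 z + g2 z"]) (simp_all add: algebra_simps)
  qed
  then show ?thesis using f by (auto simp: bv_closure_def)
qed

lemma bv_closure_scale:
  assumes "\<And>g. g \<in> G \<Longrightarrow> (\<lambda>z. a * g z) \<in> G" and f: "f \<in> bv_closure \<sigma> G"
  shows "(\<lambda>z. a * f z) \<in> bv_closure \<sigma> G"
proof -
  have "\<exists>g\<in>G. bv_bound \<sigma> (\<lambda>z. a * f z - g z) \<epsilon>" if "\<epsilon> > 0" for \<epsilon>
  proof -
    have "\<epsilon> / (norm a + 1) > 0" using that by (simp add: add_nonneg_pos)
    then obtain g where g: "g \<in> G" "bv_bound \<sigma> (\<lambda>z. f z - g z) (\<epsilon> / (norm a + 1))"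
      using f by (auto simp: bv_closure_def)
    have "norm a * (\<epsilon> / (norm a + 1)) \<le> \<epsilon>"
      using that add_nonneg_pos[OF norm_ge_zero[of a] zero_less_one] by (simp add: divide_le_eq algebra_simps)
    then show ?thesis using assms(1)[OF g(1)] bv_bound_mono[OF bv_bound_scale[OF g(2), of a]]
      by (intro bexI[of _ "\<lambda>z. a * g z"]) (simp_all add: algebra_simps)
  qed
  then show ?thesis using f by (auto simp: bv_closure_def)
qed

lemma bv_closure_mult:
  assumes mult: "\<And>f g. f \<in> G \<Longrightarrow> g \<in> G \<Longrightarrow> (\<lambda>z. f z * g z) \<in> G"
    and bd: "\<And>g. g \<in> G \<Longrightarrow> \<exists>B. bv_bound \<sigma> g B"
    and f: "f1 \<in> bv_closure \<sigma> G" "f2 \<in> bv_closure \<sigma> G"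
  shows "(\<lambda>z. f1 z * f2 z) \<in> bv_closure \<sigma> G"
proof -
  obtain A where A: "bv_bound \<sigma> f1 A" using bv_closure_bounded[OF f(1) bd] by auto
  have approx: "\<exists>\<eta>>0. 2 * B * \<eta> \<le> \<epsilon> / 2" if "0 \<le> B" "\<epsilon> > 0" for B \<epsilon> :: real
    using that by (intro exI[of _ "\<epsilon> / (4 * (B + 1))"]) (simp add: field_simps)
  have "\<exists>g\<in>G. bv_bound \<sigma> (\<lambda>z. f1 z * f2 z - g z) \<epsilon>" if \<epsilon>: "\<epsilon> > 0" for \<epsilon>
  proof -
    obtain \<eta> where \<eta>: "\<eta> > 0" "2 * A * \<eta> \<le> \<epsilon> / 2" using approx bv_bound_nonneg[OF A] \<epsilon> by blast
    \<comment> \<open>\<open>g2\<close> is chosen before \<open>g1\<close>: the tolerance for \<open>g1\<close> depends on the bound \<open>C\<close> of \<open>g2\<close>\<close>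
    obtain g2 where g2: "g2 \<in> G" "bv_bound \<sigma> (\<lambda>z. f2 z - g2 z) \<eta>"
      using f \<eta> by (auto simp: bv_closure_def)
    obtain C where C: "bv_bound \<sigma> g2 C" using bd g2 by auto
    obtain \<theta> where \<theta>: "\<theta> > 0" "2 * C * \<theta> \<le> \<epsilon> / 2" using approx bv_bound_nonneg[OF C] \<epsilon> by blast
    obtain g1 where g1: "g1 \<in> G" "bv_bound \<sigma> (\<lambda>z. f1 z - g1 z) \<theta>"
      using f \<theta> by (auto simp: bv_closure_def)
    have "bv_bound \<sigma> (\<lambda>z. f1 z * (f2 z - g2 z) + (f1 z - g1 z) * g2 z) (2 * A * \<eta> + 2 * \<theta> * C)"
      by (intro bv_bound_add bv_bound_mult A C g1 g2)
    then have "bv_bound \<sigma> (\<lambda>z. f1 z * f2 z - g1 z * g2 z) (2 * A * \<eta> + 2 * \<theta> * C)"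
      by (simp add: algebra_simps)
    then show ?thesis using mult[OF g1(1) g2(1)] \<eta> \<theta>
      by (intro bexI[of _ "\<lambda>z. g1 z * g2 z"]) (auto intro: bv_bound_mono simp: mult_ac)
  qed
  then show ?thesis using f by (auto simp: bv_closure_def)
qed

section \<open>AC as the closure of the functions constant near zero\<close>

definition const_near_zero :: "complex set \<Rightarrow> (complex \<Rightarrow> complex) set" where
  "const_near_zero \<sigma> = {f. (\<forall>z. z \<notin> \<sigma> \<longrightarrow> f z = 0) \<and> (\<exists>\<delta>>0. \<forall>z\<in>\<sigma>. norm z < \<delta> \<longrightarrow> f z = f 0)}"

lemma const_near_zero_binop:
  assumes "f \<in> const_near_zero \<sigma>" "g \<in> const_near_zero \<sigma>" "F 0 0 = 0"
  shows "(\<lambda>z. F (f z) (g z)) \<in> const_near_zero \<sigma>"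
proof -
  obtain d e where d: "d > 0" "\<And>z. z \<in> \<sigma> \<Longrightarrow> norm z < d \<Longrightarrow> f z = f 0"
      and e: "e > 0" "\<And>z. z \<in> \<sigma> \<Longrightarrow> norm z < e \<Longrightarrow> g z = g 0"
    using assms unfolding const_near_zero_def by blast
  have "F (f z) (g z) = F (f 0) (g 0)" if "z \<in> \<sigma>" "norm z < min d e" for z
    using d(2)[of z] e(2)[of z] that by simp
  then show ?thesis
    using assms d(1) e(1) unfolding const_near_zero_def mem_Collect_eq
    by (intro conjI exI[of _ "min d e"]) auto
qed

lemma indicator_in_const_near_zero: "indicator \<sigma> \<in> const_near_zero \<sigma>" if "0 \<in> \<sigma>"
  using that by (auto simp: const_near_zero_def indicator_def intro: exI[of _ 1])

lemma indicator_finite_in_const_near_zero: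
  assumes "finite A" "A \<subseteq> \<sigma> - {0}"
  shows "indicator A \<in> const_near_zero \<sigma>"
proof -
  have "open (- A)" using assms by (simp add: finite_imp_closed open_Compl)
  moreover have "0 \<in> - A" using assms by auto
  ultimately obtain d where "d > 0" "\<forall>z. dist z 0 < d \<longrightarrow> z \<in> - A" unfolding open_dist by blast
  then show ?thesis using assms
    by (auto simp: const_near_zero_def indicator_def intro!: exI[of _ d])
qed

text \<open>Off the neighbourhood of \<open>0\<close> there are only finitely many points, so such a function is a finite
  linear combination of the unit and of indicators of isolated points.\<close>

lemma const_near_zero_induct [consumes 2, case_names unit point add scale]:
  assumes \<sigma>: "real_C_set \<sigma>" and f: "f \<in> const_near_zero \<sigma>"
    and unit: "Q (indicator \<sigma>)" and point: "\<And>a. a \<in> \<sigma> \<Longrightarrow> a \<noteq> 0 \<Longrightarrow> Q (indicator {a})"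
    and add: "\<And>f g. Q f \<Longrightarrow> Q g \<Longrightarrow> Q (\<lambda>z. f z + g z)"
    and scale: "\<And>c f. Q f \<Longrightarrow> Q (\<lambda>z. c * f z)"
  shows "Q f"
proof -
  obtain d where d: "d > 0" "\<And>z. z \<in> \<sigma> \<Longrightarrow> norm z < d \<Longrightarrow> f z = f 0"
    using f by (auto simp: const_near_zero_def)
  define F where "F = {z\<in>\<sigma>. d \<le> norm z}"
  have fin: "finite F" using real_C_set_finite_away[OF \<sigma> d(1)] by (simp add: F_def)
  have sum: "Q (\<lambda>z. f 0 * indicator \<sigma> z + (\<Sum>a\<in>A. (f a - f 0) * indicator {a} z))" if "A \<subseteq> F" for A
    using finite_subset[OF that fin] that
  proof (induction A rule: finite_induct)
    case empty
    then show ?case using scale[OF unit] by simp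
  next
    case (insert a A)
    have "a \<in> \<sigma>" "a \<noteq> 0" using insert.prems d by (auto simp: F_def)
    then have "Q (\<lambda>z. (f 0 * indicator \<sigma> z + (\<Sum>a\<in>A. (f a - f 0) * indicator {a} z)) +
        (f a - f 0) * indicator {a} z)"
      using insert by (intro add[OF _ scale] point) auto
    then show ?case by (simp only: sum.insert[OF insert.hyps] add_ac)
  qed
  have "f z = f 0 * indicator \<sigma> z + (\<Sum>a\<in>F. (f a - f 0) * indicator {a} z)" for z
  proof -
    have "(\<Sum>a\<in>F. (f a - f 0) * indicator {a} z) = (\<Sum>a\<in>F. if a = z then f a - f 0 else 0)"
      by (intro sum.cong refl) (auto simp: indicator_def)
    also have "\<dots> = (if z \<in> F then f z - f 0 else 0)" using fin by (simp add: sum.delta')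
    finally show ?thesis using f d by (auto simp: indicator_def F_def const_near_zero_def)
  qed
  then have "f = (\<lambda>z. f 0 * indicator \<sigma> z + (\<Sum>a\<in>F. (f a - f 0) * indicator {a} z))" by (rule ext)
  then show ?thesis using sum[of F] by simp
qed

lemma bv_bound_indicator: "bv_bound \<sigma> (indicator \<sigma>) 1"
  by (rule bv_bound_majorant[where m = "\<lambda>_. 0"]) (auto simp: indicator_def)

lemma bv_bound_indicator_singleton: "\<sigma> \<subseteq> \<real> \<Longrightarrow> bv_bound \<sigma> (indicator {a}) 2"
  by (rule bv_bound_majorant[where m = "\<lambda>z. if Re z < Re a then 0 else if Re z = Re a then 1 else 2"])
    (auto simp: indicator_def)

lemma const_near_zero_bounded:
  assumes \<sigma>: "real_C_set \<sigma>" and "f \<in> const_near_zero \<sigma>"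
  shows "\<exists>B. bv_bound \<sigma> f B"
  using assms
proof (induction rule: const_near_zero_induct)
  case (point a)
  then show ?case using bv_bound_indicator_singleton[OF real_C_set_subset_Reals[OF \<sigma>]] by blast
qed (use bv_bound_indicator bv_bound_add bv_bound_scale in blast)+

text \<open>Subtracting from \<open>x\<close> its truncation to \<open>[-e/2, e/2]\<close> leaves a function vanishing near \<open>0\<close>; the
  truncation is monotone, hence its variation is at most the length \<open>e\<close>.\<close>

lemma coordinate_in_bv_closure:
  assumes \<sigma>: "real_C_set \<sigma>"
  shows "(\<lambda>z. if z \<in> \<sigma> then z else 0) \<in> bv_closure \<sigma> (const_near_zero \<sigma>)"
proof -
  have "\<exists>g\<in>const_near_zero \<sigma>. bv_bound \<sigma> (\<lambda>z. (if z \<in> \<sigma> then z else 0) - g z) e" if e: "e > 0" for e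
  proof -
    define m where "m z = max (- e / 2) (min (e / 2) (Re z))" for z
    define g where "g z = (if z \<in> \<sigma> then z - of_real (m z) else 0)" for z
    have "g z = g 0" if "z \<in> \<sigma>" "norm z < e / 2" for z
    proof -
      have "\<bar>Re z\<bar> < e / 2" using abs_Re_le_cmod[of z] that by simp
      then show ?thesis using that real_C_set_subset_Reals[OF \<sigma>] e
        by (auto simp: g_def m_def complex_eq_iff complex_is_Real_iff)
    qed
    then have "g \<in> const_near_zero \<sigma>"
      using e by (auto simp: const_near_zero_def g_def intro!: exI[of _ "e / 2"])
    moreover have "bv_bound \<sigma> (\<lambda>z. of_real (m z)) e"
      by (rule bv_bound_majorant[where m = "\<lambda>z. m z + e / 2"])
        (use e in \<open>auto simp: m_def simp flip: of_real_diff\<close>)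
    then have "bv_bound \<sigma> (\<lambda>z. (if z \<in> \<sigma> then z else 0) - g z) e"
      by (rule bv_bound_cong[rotated]) (simp add: g_def)
    ultimately show ?thesis by blast
  qed
  then show ?thesis by (simp add: bv_closure_def)
qed

definition poly_on :: "complex set \<Rightarrow> complex poly \<Rightarrow> complex \<Rightarrow> complex" where
  "poly_on \<sigma> P = (\<lambda>z. if z \<in> \<sigma> then poly P z else 0)"

text \<open>The second variable vanishes on the real line, and only polynomials in one variable remain.\<close>

lemma poly_restrictions_real:
  assumes "\<sigma> \<subseteq> \<real>"
  shows "poly_restrictions \<sigma> = range (poly_on \<sigma>)"
proof (intro equalityI subsetI)
  have real: "complex_of_real (Re z) = z" "Im z = 0" if "z \<in> \<sigma>" for z
    using that assms by (auto simp: complex_is_Real_iff complex_eq_iff)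
  { fix f assume "f \<in> poly_restrictions \<sigma>"
    then obtain c :: "nat \<Rightarrow> nat \<Rightarrow> complex" and N where f: "f = (\<lambda>z. if z \<in> \<sigma>
        then \<Sum>n\<le>N. \<Sum>m\<le>N. c n m * of_real (Re z) ^ n * of_real (Im z) ^ m else 0)"
      by (auto simp: poly_restrictions_def)
    have "f = poly_on \<sigma> (\<Sum>n\<le>N. \<Sum>m\<le>N. monom (c n m * 0 ^ m) n)"
      by (auto simp: f poly_on_def fun_eq_iff real poly_sum poly_monom mult_ac intro!: sum.cong)
    then show "f \<in> range (poly_on \<sigma>)" by blast }
  fix f assume "f \<in> range (poly_on \<sigma>)"
  then obtain P where f: "f = poly_on \<sigma> P" by blast
  have "poly P z = (\<Sum>n\<le>degree P. \<Sum>m\<le>degree P.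
      (if m = 0 then coeff P n else 0) * of_real (Re z) ^ n * of_real (Im z) ^ m)" if "z \<in> \<sigma>" for z
  proof -
    have "(\<Sum>m\<le>degree P. (if m = 0 then coeff P n else 0) * z ^ n * 0 ^ m) = coeff P n * z ^ n" for n
    proof -
      have "(\<Sum>m\<le>degree P. (if m = 0 then coeff P n else 0) * z ^ n * 0 ^ m) =
          (\<Sum>m\<le>degree P. if m = 0 then coeff P n * z ^ n else 0)"
        by (intro sum.cong) auto
      then show ?thesis by simp
    qed
    then show ?thesis using real[OF that] by (simp add: poly_altdef)
  qed
  then show "f \<in> poly_restrictions \<sigma>" unfolding f poly_on_def poly_restrictions_def
    by (intro CollectI exI[of _ "\<lambda>n m. if m = 0 then coeff P n else 0"] exI[of _ "degree P"]) auto
qed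

lemma const_near_zero_subset_bv_closure: "const_near_zero \<sigma> \<subseteq> bv_closure \<sigma> (const_near_zero \<sigma>)"
  by (rule bv_closure_superset) (simp add: const_near_zero_def)

lemma bv_closure_const_near_zero_add:
  "f \<in> bv_closure \<sigma> (const_near_zero \<sigma>) \<Longrightarrow> g \<in> bv_closure \<sigma> (const_near_zero \<sigma>) \<Longrightarrow>
    (\<lambda>z. f z + g z) \<in> bv_closure \<sigma> (const_near_zero \<sigma>)"
  by (rule bv_closure_add) (auto intro: const_near_zero_binop[where F = "(+)"])

lemma bv_closure_const_near_zero_scale:
  "f \<in> bv_closure \<sigma> (const_near_zero \<sigma>) \<Longrightarrow> (\<lambda>z. a * f z) \<in> bv_closure \<sigma> (const_near_zero \<sigma>)"
  by (rule bv_closure_scale) (auto intro: const_near_zero_binop[where F = "\<lambda>x y. a * x"])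

lemma bv_closure_const_near_zero_mult:
  "real_C_set \<sigma> \<Longrightarrow> f \<in> bv_closure \<sigma> (const_near_zero \<sigma>) \<Longrightarrow> g \<in> bv_closure \<sigma> (const_near_zero \<sigma>) \<Longrightarrow>
    (\<lambda>z. f z * g z) \<in> bv_closure \<sigma> (const_near_zero \<sigma>)"
  by (rule bv_closure_mult)
    (auto intro: const_near_zero_binop[where F = "(*)"] const_near_zero_bounded)

lemma poly_on_in_bv_closure:
  assumes \<sigma>: "real_C_set \<sigma>"
  shows "poly_on \<sigma> P \<in> bv_closure \<sigma> (const_near_zero \<sigma>)"
proof (induction P)
  case 0
  have "poly_on \<sigma> 0 \<in> const_near_zero \<sigma>"
    by (auto simp: poly_on_def const_near_zero_def intro: exI[of _ 1])
  then show ?case using const_near_zero_subset_bv_closure by blast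
next
  case (pCons a P)
  have "indicator \<sigma> \<in> bv_closure \<sigma> (const_near_zero \<sigma>)"
    using const_near_zero_subset_bv_closure indicator_in_const_near_zero[OF real_C_set_zero_mem[OF \<sigma>]]
    by blast
  then have "(\<lambda>z. a * indicator \<sigma> z + (if z \<in> \<sigma> then z else 0) * poly_on \<sigma> P z)
      \<in> bv_closure \<sigma> (const_near_zero \<sigma>)"
    by (intro bv_closure_const_near_zero_add bv_closure_const_near_zero_scale
        bv_closure_const_near_zero_mult[OF \<sigma>] coordinate_in_bv_closure[OF \<sigma>] pCons.IH)
  also have "(\<lambda>z. a * indicator \<sigma> z + (if z \<in> \<sigma> then z else 0) * poly_on \<sigma> P z) = poly_on \<sigma> (pCons a P)"
    by (auto simp: poly_on_def indicator_def fun_eq_iff)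
  finally show ?case .
qed

lemma AC_eq_bv_closure_poly:
  assumes \<sigma>: "real_C_set \<sigma>"
  shows "AC \<sigma> = bv_closure \<sigma> (poly_restrictions \<sigma>)"
proof -
  note real = real_C_set_subset_Reals[OF \<sigma>]
  have poly_bd: "\<exists>B. bv_bound \<sigma> g B" if "g \<in> poly_restrictions \<sigma>" for g
    using that bv_closure_bounded[OF poly_on_in_bv_closure[OF \<sigma>] const_near_zero_bounded[OF \<sigma>]]
    by (auto simp: poly_restrictions_real[OF real])
  then have poly_BV: "poly_restrictions \<sigma> \<subseteq> BV \<sigma>"
    by (auto simp: BV_iff[OF real]) (auto simp: poly_restrictions_def)
  have AC: "f \<in> AC \<sigma> \<longleftrightarrow> f \<in> BV \<sigma> \<and> (\<forall>r>0. \<exists>g\<in>poly_restrictions \<sigma>. BV_norm \<sigma> (\<lambda>z. f z - g z) < r)" for f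
    using poly_BV
    by (auto simp: AC_def norm_topology_def Metric_space.metric_closure_of[OF Metric_space_BV]
        Metric_space.in_mball[OF Metric_space_BV] subset_iff)
  show ?thesis
  proof (intro equalityI subsetI)
    fix f assume f: "f \<in> AC \<sigma>"
    have "\<exists>g\<in>poly_restrictions \<sigma>. bv_bound \<sigma> (\<lambda>z. f z - g z) r" if r: "r > 0" for r
    proof -
      obtain g where g: "g \<in> poly_restrictions \<sigma>" "BV_norm \<sigma> (\<lambda>z. f z - g z) < r"
        using f r by (auto simp: AC)
      have "(\<lambda>z. f z - g z) \<in> BV \<sigma>"
        using f g poly_BV BV_diff_finite[of f \<sigma> g] by (auto simp: AC BV_def subset_iff)
      from bv_bound_mono[OF bv_bound_BV_norm[OF real this]] g show ?thesis by (intro bexI[of _ g]) simp_all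
    qed
    then show "f \<in> bv_closure \<sigma> (poly_restrictions \<sigma>)" using f by (auto simp: bv_closure_def AC BV_def)
  next
    fix f assume f: "f \<in> bv_closure \<sigma> (poly_restrictions \<sigma>)"
    have "f \<in> BV \<sigma>" using bv_closure_bounded[OF f poly_bd] f by (auto simp: BV_iff[OF real] bv_closure_def)
    moreover have "\<exists>g\<in>poly_restrictions \<sigma>. BV_norm \<sigma> (\<lambda>z. f z - g z) < r" if r: "r > 0" for r
    proof -
      obtain g where g: "g \<in> poly_restrictions \<sigma>" "bv_bound \<sigma> (\<lambda>z. f z - g z) (r / 3)"
        using f r by (auto simp: bv_closure_def dest!: spec[of _ "r / 3"])
      then show ?thesis using BV_norm_le[OF real g(2)] r by (intro bexI[of _ g]) auto
    qed
    ultimately show "f \<in> AC \<sigma>" by (simp add: AC)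
  qed
qed

text \<open>With \<open>R\<close> at least the distance from \<open>a\<close> to all points, the polynomial
  \<open>(1 - ((x - a) / R)\<^sup>2) ^ n\<close> is 1 at \<open>a\<close>, increases on the left of \<open>a\<close> and decreases on the right.
  As \<open>a\<close> is isolated, it is at most \<open>\<theta> ^ n\<close> at the other points for some \<open>\<theta> < 1\<close>, and by
  monotonicity its variation off \<open>a\<close> is of the same size.\<close>

lemma point_indicator_in_bv_closure_poly:
  assumes \<sigma>: "real_C_set \<sigma>" and a: "a \<in> \<sigma>" "a \<noteq> 0"
  shows "indicator {a} \<in> bv_closure \<sigma> (poly_restrictions \<sigma>)"
proof -
  note real = real_C_set_subset_Reals[OF \<sigma>]
  obtain e where e: "e > 0" "\<And>x. x \<in> \<sigma> \<Longrightarrow> x \<noteq> a \<Longrightarrow> e \<le> norm (x - a)"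
    using real_C_set_isolated[OF \<sigma> a(2)] by blast
  have "bounded \<sigma>" using \<sigma> compact_imp_bounded by (auto simp: real_C_set_def C_set_def)
  then obtain R' where R': "\<And>x. x \<in> \<sigma> \<Longrightarrow> dist a x \<le> R'" using bounded_any_center by blast
  \<comment> \<open>\<open>R\<close> is at least \<open>e\<close>, so that \<open>\<theta>\<close> below is nonnegative\<close>
  define R where "R = max R' e"
  have R: "R > 0" "e \<le> R" "\<And>x. x \<in> \<sigma> \<Longrightarrow> norm (x - a) \<le> R"
    using R' e by (auto simp: R_def dist_norm norm_minus_commute max.coboundedI1)
  define \<phi> where "\<phi> z = 1 - ((Re z - Re a) / R)\<^sup>2" for z
  define \<theta> where "\<theta> = 1 - (e / R)\<^sup>2"
  have norm_Re: "norm (x - a) = \<bar>Re x - Re a\<bar>" if "x \<in> \<sigma>" for x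
    using that a real by (auto simp: subset_iff complex_is_Real_iff cmod_def)
  have \<phi>_nonneg: "0 \<le> \<phi> z" if "z \<in> \<sigma>" for z
    using R(3)[OF that] R(1) norm_Re[OF that]
    by (simp add: \<phi>_def power_divide divide_le_eq abs_le_square_iff[symmetric])
  have \<phi>_le: "\<phi> z \<le> \<theta>" if "z \<in> \<sigma>" "z \<noteq> a" for z
    using e(2)[OF that] e(1) R(1) norm_Re[OF that(1)]
    by (simp add: \<phi>_def \<theta>_def power_divide divide_right_mono abs_le_square_iff[symmetric])
  have \<theta>: "0 \<le> \<theta>" "\<theta> < 1" using R e by (auto simp: \<theta>_def power_divide abs_le_square_iff[symmetric])
  have unimodal: "\<phi> x \<le> \<phi> y" if "\<bar>Re y - Re a\<bar> \<le> \<bar>Re x - Re a\<bar>" for x y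
    using that R(1) by (simp add: \<phi>_def power_divide divide_right_mono abs_le_square_iff[symmetric])
  have "\<exists>g\<in>poly_restrictions \<sigma>. bv_bound \<sigma> (\<lambda>z. indicator {a} z - g z) \<epsilon>" if \<epsilon>: "\<epsilon> > 0" for \<epsilon>
  proof -
    obtain n where n: "\<theta> ^ n < \<epsilon> / 4" using real_arch_pow_inv[of "\<epsilon> / 4" \<theta>] \<theta> \<epsilon> by auto
    define t where "t = \<theta> ^ n"
    define g where "g = poly_on \<sigma> ((1 - smult (1 / (of_real R)\<^sup>2) ([:- a, 1:]\<^sup>2)) ^ n)"
    define k where "k z = (if z = a then 0 else \<phi> z ^ n)" for z
    have g: "g z = of_real (\<phi> z ^ n)" if "z \<in> \<sigma>" for z
    proof -
      have "z - a = of_real (Re z - Re a)"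
        using that a real by (auto simp: subset_iff complex_is_Real_iff complex_eq_iff)
      moreover have "poly [:- a, 1:] z = z - a" by simp
      ultimately have "poly [:- a, 1:] z = of_real (Re z - Re a)" by (simp only:)
      then show ?thesis using that
        by (simp add: g_def poly_on_def \<phi>_def power_divide poly_power del: poly_pCons)
    qed
    have "\<phi> a = 1" by (simp add: \<phi>_def)
    then have kg: "indicator {a} z - g z = of_real (- k z)" if "z \<in> \<sigma>" for z
      using g[OF that] by (auto simp: k_def indicator_def)
    have t: "0 \<le> t" "4 * t \<le> \<epsilon>" using \<theta> n by (auto simp: t_def)
    have k: "0 \<le> k z" "k z \<le> t" if "z \<in> \<sigma>" for z
      using \<phi>_nonneg[OF that] \<phi>_le[OF that] t(1) by (auto simp: k_def t_def intro: power_mono)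
    have k_left: "k x \<le> k y" if "x \<in> \<sigma>" "y \<in> \<sigma>" "Re x < Re y" "Re y < Re a" for x y
      using that unimodal[of y x] \<phi>_nonneg[of x] by (auto simp: k_def intro!: power_mono)
    have k_right: "k y \<le> k x" if "x \<in> \<sigma>" "y \<in> \<sigma>" "Re x < Re y" "Re a < Re x" for x y
      using that unimodal[of x y] \<phi>_nonneg[of y] by (auto simp: k_def intro!: power_mono)
    have eq_a: "x = a" if "x \<in> \<sigma>" "Re x = Re a" for x
      using that a real by (auto simp: subset_iff complex_is_Real_iff complex_eq_iff)
    \<comment> \<open>the two jumps at \<open>a\<close>, each of size at least \<open>t\<close>, leave room for the increments across \<open>a\<close>\<close>
    define m where "m z = (if Re z < Re a then k z else if Re z = Re a then 2 * t else 4 * t - k z)" for z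
    have ka: "k a = 0" by (simp add: k_def)
    have "bv_bound \<sigma> (\<lambda>z. of_real (- k z)) \<epsilon>"
    proof (rule bv_bound_majorant[where m = m])
      fix x y assume xy: "x \<in> \<sigma>" "y \<in> \<sigma>" "Re x < Re y"
      have "\<bar>k x - k y\<bar> \<le> m y - m x"
        using xy k[of x] k[of y] k_left[of x y] k_right[of x y] eq_a[of x] eq_a[of y] ka t(1)
        unfolding m_def by (smt (verit))
      then show "norm (complex_of_real (- k y) - of_real (- k x)) \<le> m y - m x"
        by (simp flip: of_real_diff of_real_minus)
    next
      fix z assume "z \<in> \<sigma>"
      then show "0 \<le> m z \<and> m z \<le> \<epsilon>" "norm (complex_of_real (- k z)) \<le> \<epsilon>"
        using k[of z] t by (auto simp: m_def)
    qed (use \<epsilon> in auto)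
    then have "bv_bound \<sigma> (\<lambda>z. indicator {a} z - g z) \<epsilon>"
      by (rule bv_bound_cong[rotated]) (simp add: kg)
    moreover have "g \<in> poly_restrictions \<sigma>"
      unfolding g_def poly_restrictions_real[OF real] by blast
    ultimately show ?thesis by blast
  qed
  then show ?thesis using a by (auto simp: bv_closure_def indicator_def)
qed

text \<open>Each of the two generating families lies in the closure of the other.\<close>

lemma AC_eq_bv_closure:
  assumes \<sigma>: "real_C_set \<sigma>"
  shows "AC \<sigma> = bv_closure \<sigma> (const_near_zero \<sigma>)"
proof -
  note poly = poly_restrictions_real[OF real_C_set_subset_Reals[OF \<sigma>]]
  have add: "(\<lambda>z. f z + g z) \<in> poly_restrictions \<sigma>"
    if "f \<in> poly_restrictions \<sigma>" "g \<in> poly_restrictions \<sigma>" for f g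
  proof -
    obtain P Q where "f = poly_on \<sigma> P" "g = poly_on \<sigma> Q" using \<open>f \<in> _\<close> \<open>g \<in> _\<close> poly by auto
    then have "(\<lambda>z. f z + g z) = poly_on \<sigma> (P + Q)" by (auto simp: poly_on_def)
    then show ?thesis by (simp add: poly)
  qed
  have scale: "(\<lambda>z. c * f z) \<in> poly_restrictions \<sigma>" if "f \<in> poly_restrictions \<sigma>" for f c
  proof -
    obtain P where "f = poly_on \<sigma> P" using \<open>f \<in> _\<close> poly by auto
    then have "(\<lambda>z. c * f z) = poly_on \<sigma> (smult c P)" by (auto simp: poly_on_def)
    then show ?thesis by (simp add: poly)
  qed
  have "f \<in> bv_closure \<sigma> (poly_restrictions \<sigma>)" if "f \<in> const_near_zero \<sigma>" for f
    using \<sigma> that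
  proof (induction rule: const_near_zero_induct)
    case unit
    have "poly_on \<sigma> 1 \<in> bv_closure \<sigma> (range (poly_on \<sigma>))"
      by (intro subsetD[OF bv_closure_superset]) (auto simp: poly_on_def)
    moreover have "indicator \<sigma> = poly_on \<sigma> 1" by (auto simp: poly_on_def indicator_def)
    ultimately show ?case by (simp add: poly)
  qed (auto intro: point_indicator_in_bv_closure_poly[OF \<sigma>] bv_closure_add[OF add] bv_closure_scale[OF scale])
  then have "bv_closure \<sigma> (const_near_zero \<sigma>) \<subseteq> bv_closure \<sigma> (poly_restrictions \<sigma>)"
    by (intro bv_closure_least subsetI)
  moreover have "bv_closure \<sigma> (poly_restrictions \<sigma>) \<subseteq> bv_closure \<sigma> (const_near_zero \<sigma>)"
    using poly_on_in_bv_closure[OF \<sigma>] by (intro bv_closure_least) (auto simp: poly)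
  ultimately show ?thesis using AC_eq_bv_closure_poly[OF \<sigma>] by auto
qed

section \<open>The algebra structure of AC and its isomorphisms\<close>

lemma AC_zero_outside: "f \<in> AC \<sigma> \<Longrightarrow> z \<notin> \<sigma> \<Longrightarrow> f z = 0"
  using AC_subset_BV by (auto simp: BV_def)

lemma AC_add: "real_C_set \<sigma> \<Longrightarrow> f \<in> AC \<sigma> \<Longrightarrow> g \<in> AC \<sigma> \<Longrightarrow> (\<lambda>z. f z + g z) \<in> AC \<sigma>"
  by (simp add: AC_eq_bv_closure bv_closure_const_near_zero_add)

lemma AC_scale: "real_C_set \<sigma> \<Longrightarrow> f \<in> AC \<sigma> \<Longrightarrow> (\<lambda>z. a * f z) \<in> AC \<sigma>"
  by (simp add: AC_eq_bv_closure bv_closure_const_near_zero_scale)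

lemma AC_mult: "real_C_set \<sigma> \<Longrightarrow> f \<in> AC \<sigma> \<Longrightarrow> g \<in> AC \<sigma> \<Longrightarrow> (\<lambda>z. f z * g z) \<in> AC \<sigma>"
  by (simp add: AC_eq_bv_closure bv_closure_const_near_zero_mult)

lemma AC_diff: "real_C_set \<sigma> \<Longrightarrow> f \<in> AC \<sigma> \<Longrightarrow> g \<in> AC \<sigma> \<Longrightarrow> (\<lambda>z. f z - g z) \<in> AC \<sigma>"
  using AC_add[of \<sigma> f "\<lambda>z. - 1 * g z"] AC_scale[of \<sigma> g "- 1"] by simp

lemma indicator_finite_in_AC: "real_C_set \<sigma> \<Longrightarrow> finite A \<Longrightarrow> A \<subseteq> \<sigma> - {0} \<Longrightarrow> indicator A \<in> AC \<sigma>"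
  using indicator_finite_in_const_near_zero const_near_zero_subset_bv_closure
  by (simp add: AC_eq_bv_closure) blast

lemma AC_alg_sel [simp]: "fst (AC_alg \<sigma>) = AC \<sigma>" "snd (AC_alg \<sigma>) = BV_norm \<sigma>"
  by (simp_all add: AC_alg_def)

lemma topspace_AC [simp]: "topspace (norm_topology (AC_alg \<sigma>)) = AC \<sigma>"
  by (simp add: norm_topology_def Metric_space.topspace_mtopology[OF Metric_space_AC])

lemma continuous_map_AC_iff:
  "continuous_map (norm_topology (AC_alg \<sigma>)) (norm_topology (AC_alg \<tau>)) \<Phi> \<longleftrightarrow>
    \<Phi> ` AC \<sigma> \<subseteq> AC \<tau> \<and> (\<forall>f\<in>AC \<sigma>. \<forall>\<epsilon>>0. \<exists>\<delta>>0. \<forall>g. g \<in> AC \<sigma> \<and> BV_norm \<sigma> (\<lambda>z. f z - g z) < \<delta> \<longrightarrow>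
      BV_norm \<tau> (\<lambda>z. \<Phi> f z - \<Phi> g z) < \<epsilon>)"
  unfolding norm_topology_def AC_alg_sel
  by (rule Metric_space.metric_continuous_map[OF Metric_space_AC Metric_space_AC])

lemma continuous_map_AC:
  assumes \<sigma>: "real_C_set \<sigma>" and \<tau>: "real_C_set \<tau>"
    and maps: "\<And>f. f \<in> AC \<sigma> \<Longrightarrow> \<Phi> f \<in> AC \<tau>"
    and diff: "\<And>f g. f \<in> AC \<sigma> \<Longrightarrow> g \<in> AC \<sigma> \<Longrightarrow> \<Phi> (\<lambda>z. f z - g z) = (\<lambda>z. \<Phi> f z - \<Phi> g z)"
    and bound: "\<And>f B. f \<in> AC \<sigma> \<Longrightarrow> bv_bound \<sigma> f B \<Longrightarrow> bv_bound \<tau> (\<Phi> f) (K * B)" and K: "K > 0"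
  shows "continuous_map (norm_topology (AC_alg \<sigma>)) (norm_topology (AC_alg \<tau>)) \<Phi>"
  unfolding continuous_map_AC_iff
proof (intro conjI ballI allI impI)
  fix f e assume f: "f \<in> AC \<sigma>" and e: "(0::real) < e"
  have "BV_norm \<tau> (\<lambda>z. \<Phi> f z - \<Phi> g z) < e"
    if g: "g \<in> AC \<sigma>" "BV_norm \<sigma> (\<lambda>z. f z - g z) < e / (2 * K)" for g
  proof -
    let ?N = "BV_norm \<sigma> (\<lambda>z. f z - g z)"
    have "(\<lambda>z. f z - g z) \<in> AC \<sigma>" using f g \<sigma> by (intro AC_diff)
    moreover from this have "bv_bound \<sigma> (\<lambda>z. f z - g z) ?N"
      using AC_subset_BV by (intro bv_bound_BV_norm real_C_set_subset_Reals[OF \<sigma>]) blast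
    ultimately have "bv_bound \<tau> (\<lambda>z. \<Phi> f z - \<Phi> g z) (K * ?N)"
      using bound diff[OF f g(1)] by metis
    from BV_norm_le[OF real_C_set_subset_Reals[OF \<tau>] this] show ?thesis
      using g K by (simp add: field_simps)
  qed
  moreover have "e / (2 * K) > 0" using e K by simp
  ultimately show "\<exists>\<delta>>0. \<forall>g. g \<in> AC \<sigma> \<and> BV_norm \<sigma> (\<lambda>z. f z - g z) < \<delta> \<longrightarrow>
      BV_norm \<tau> (\<lambda>z. \<Phi> f z - \<Phi> g z) < e" by blast
qed (use maps in blast)

text \<open>Continuity at \<open>0\<close> together with homogeneity makes \<open>\<Phi>\<close> bounded on every ball.\<close>

lemma continuous_map_AC_bound:
  assumes \<sigma>: "real_C_set \<sigma>" and \<tau>: "real_C_set \<tau>"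
    and cont: "continuous_map (norm_topology (AC_alg \<sigma>)) (norm_topology (AC_alg \<tau>)) \<Phi>"
    and scale: "\<And>a f. f \<in> AC \<sigma> \<Longrightarrow> \<Phi> (\<lambda>z. a * f z) = (\<lambda>z. a * \<Phi> f z)"
  obtains K where "\<And>f. f \<in> AC \<sigma> \<Longrightarrow> bv_bound \<sigma> f B \<Longrightarrow> bv_bound \<tau> (\<Phi> f) K"
proof (cases "0 \<le> B")
  case True
  have "indicator {} = (\<lambda>z::complex. 0::complex)" by (simp add: fun_eq_iff)
  then have zero: "(\<lambda>z. 0) \<in> AC \<sigma>" using indicator_finite_in_AC[OF \<sigma>, of "{}"] by simp
  have \<Phi>0: "\<Phi> (\<lambda>z. 0) = (\<lambda>z. 0)" using scale[OF zero, of 0] by simp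
  have maps: "\<Phi> ` AC \<sigma> \<subseteq> AC \<tau>"
    and cont0: "\<exists>\<delta>>0. \<forall>g. g \<in> AC \<sigma> \<and> BV_norm \<sigma> (\<lambda>z. 0 - g z) < \<delta> \<longrightarrow>
      BV_norm \<tau> (\<lambda>z. \<Phi> (\<lambda>z. 0) z - \<Phi> g z) < 1"
    using cont zero unfolding continuous_map_AC_iff by (blast, fastforce)
  obtain d where d: "d > 0"
      "\<And>g. g \<in> AC \<sigma> \<Longrightarrow> BV_norm \<sigma> (\<lambda>z. 0 - g z) < d \<Longrightarrow> BV_norm \<tau> (\<lambda>z. \<Phi> (\<lambda>z. 0) z - \<Phi> g z) < 1"
    using cont0 by blast
  \<comment> \<open>with \<^const>\<open>BV_norm\<close> at most twice a bound, scaling by \<open>c\<close>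
    brings every function bounded by \<open>B\<close> into the \<open>d\<close>-ball\<close>
  define c where "c = d / (4 * (B + 1))"
  have c: "c > 0" "2 * (c * B) < d" using d(1) True by (auto simp: c_def field_simps add_pos_nonneg)
  show ?thesis
  proof (rule that[of "1 / c"])
    fix f assume f: "f \<in> AC \<sigma>" "bv_bound \<sigma> f B"
    have cf: "(\<lambda>z. of_real c * f z) \<in> AC \<sigma>" using \<sigma> f by (intro AC_scale)
    have "bv_bound \<sigma> (\<lambda>z. 0 - of_real c * f z) (c * B)"
      using bv_bound_scale[OF f(2), of "- of_real c"] c by simp
    from BV_norm_le[OF real_C_set_subset_Reals[OF \<sigma>] this] c
    have "BV_norm \<sigma> (\<lambda>z. 0 - of_real c * f z) < d" by simp
    then have *: "BV_norm \<tau> (\<lambda>z. - of_real c * \<Phi> f z) < 1"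
      using d(2)[OF cf] by (simp add: \<Phi>0 scale[OF f(1)])
    have "(\<lambda>z. - of_real c * \<Phi> f z) \<in> BV \<tau>"
      using AC_scale[OF \<tau>, of "\<Phi> f"] maps f AC_subset_BV by blast
    from bv_bound_mono[OF bv_bound_BV_norm[OF real_C_set_subset_Reals[OF \<tau>] this] less_imp_le[OF *]]
    have "bv_bound \<tau> (\<lambda>z. - of_real (1 / c) * (- of_real c * \<Phi> f z)) (norm (- complex_of_real (1 / c)) * 1)"
      by (rule bv_bound_scale)
    then show "bv_bound \<tau> (\<Phi> f) (1 / c)" using c by (simp add: norm_divide)
  qed
next
  case False
  then show ?thesis using that bv_bound_nonneg by blast
qed

lemma banach_alg_iso_refl: "banach_alg_iso (AC_alg \<sigma>) (AC_alg \<sigma>)"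
  unfolding banach_alg_iso_def
  by (intro exI[of _ id] conjI) (auto intro: continuous_map_eq[OF continuous_map_id] simp: inv_into_f_f[of id, simplified])

lemma banach_alg_iso_sym:
  assumes \<sigma>: "real_C_set \<sigma>" and iso: "banach_alg_iso (AC_alg \<sigma>) (AC_alg \<tau>)"
  shows "banach_alg_iso (AC_alg \<tau>) (AC_alg \<sigma>)"
proof -
  obtain \<Phi> where bij: "bij_betw \<Phi> (AC \<sigma>) (AC \<tau>)"
    and add: "\<And>f g. f \<in> AC \<sigma> \<Longrightarrow> g \<in> AC \<sigma> \<Longrightarrow> \<Phi> (\<lambda>z. f z + g z) = (\<lambda>z. \<Phi> f z + \<Phi> g z)"
    and scale: "\<And>a f. f \<in> AC \<sigma> \<Longrightarrow> \<Phi> (\<lambda>z. a * f z) = (\<lambda>z. a * \<Phi> f z)"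
    and mult: "\<And>f g. f \<in> AC \<sigma> \<Longrightarrow> g \<in> AC \<sigma> \<Longrightarrow> \<Phi> (\<lambda>z. f z * g z) = (\<lambda>z. \<Phi> f z * \<Phi> g z)"
    and cont: "continuous_map (norm_topology (AC_alg \<sigma>)) (norm_topology (AC_alg \<tau>)) \<Phi>"
    and cont': "continuous_map (norm_topology (AC_alg \<tau>)) (norm_topology (AC_alg \<sigma>)) (inv_into (AC \<sigma>) \<Phi>)"
    using iso unfolding banach_alg_iso_def AC_alg_sel by blast
  define \<Psi> where "\<Psi> = inv_into (AC \<sigma>) \<Phi>"
  have bij': "bij_betw \<Psi> (AC \<tau>) (AC \<sigma>)" unfolding \<Psi>_def by (rule bij_betw_inv_into[OF bij])
  have in_AC: "\<Psi> f \<in> AC \<sigma>" if "f \<in> AC \<tau>" for f using bij' that by (rule bij_betwE[THEN bspec])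
  have \<Phi>\<Psi>: "\<Phi> (\<Psi> f) = f" if "f \<in> AC \<tau>" for f
    unfolding \<Psi>_def by (rule bij_betw_inv_into_right[OF bij that])
  have \<Psi>\<Phi>: "\<Psi> (\<Phi> f) = f" if "f \<in> AC \<sigma>" for f
    unfolding \<Psi>_def by (rule bij_betw_inv_into_left[OF bij that])
  have inv_eq: "\<Psi> g = f" if "f \<in> AC \<sigma>" "\<Phi> f = g" for f g using \<Psi>\<Phi> that by blast
  show ?thesis unfolding banach_alg_iso_def AC_alg_sel
  proof (intro exI[of _ \<Psi>] conjI ballI allI)
    fix f g assume fg: "f \<in> AC \<tau>" "g \<in> AC \<tau>"
    show "\<Psi> (\<lambda>z. f z + g z) = (\<lambda>z. \<Psi> f z + \<Psi> g z)"
      by (rule inv_eq) (simp_all add: AC_add \<sigma> in_AC fg add \<Phi>\<Psi>)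
    show "\<Psi> (\<lambda>z. f z * g z) = (\<lambda>z. \<Psi> f z * \<Psi> g z)"
      by (rule inv_eq) (simp_all add: AC_mult \<sigma> in_AC fg mult \<Phi>\<Psi>)
  next
    fix a f assume f: "f \<in> AC \<tau>"
    show "\<Psi> (\<lambda>z. a * f z) = (\<lambda>z. a * \<Psi> f z)"
      by (rule inv_eq) (simp_all add: AC_scale \<sigma> in_AC f scale \<Phi>\<Psi>)
  next
    show "continuous_map (norm_topology (AC_alg \<sigma>)) (norm_topology (AC_alg \<tau>)) (inv_into (AC \<tau>) \<Psi>)"
    proof (rule continuous_map_eq[OF cont])
      fix f assume "f \<in> topspace (norm_topology (AC_alg \<sigma>))"
      then have f: "f \<in> AC \<sigma>" by simp
      then have "\<Phi> f \<in> AC \<tau>" using bij by (auto dest: bij_betwE)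
      then show "\<Phi> f = inv_into (AC \<tau>) \<Psi> f"
        using bij_betw_inv_into_left[OF bij', of "\<Phi> f"] \<Psi>\<Phi>[OF f] by simp
    qed
  qed (use bij' cont' in \<open>simp_all add: \<Psi>_def\<close>)
qed

lemma banach_alg_iso_trans:
  assumes "banach_alg_iso (AC_alg \<sigma>) (AC_alg \<tau>)" "banach_alg_iso (AC_alg \<tau>) (AC_alg \<upsilon>)"
  shows "banach_alg_iso (AC_alg \<sigma>) (AC_alg \<upsilon>)"
proof -
  obtain \<Phi> where bij1: "bij_betw \<Phi> (AC \<sigma>) (AC \<tau>)"
    and hom1: "\<And>f g. f \<in> AC \<sigma> \<Longrightarrow> g \<in> AC \<sigma> \<Longrightarrow> \<Phi> (\<lambda>z. f z + g z) = (\<lambda>z. \<Phi> f z + \<Phi> g z)"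
      "\<And>a f. f \<in> AC \<sigma> \<Longrightarrow> \<Phi> (\<lambda>z. a * f z) = (\<lambda>z. a * \<Phi> f z)"
      "\<And>f g. f \<in> AC \<sigma> \<Longrightarrow> g \<in> AC \<sigma> \<Longrightarrow> \<Phi> (\<lambda>z. f z * g z) = (\<lambda>z. \<Phi> f z * \<Phi> g z)"
    and cont1: "continuous_map (norm_topology (AC_alg \<sigma>)) (norm_topology (AC_alg \<tau>)) \<Phi>"
      "continuous_map (norm_topology (AC_alg \<tau>)) (norm_topology (AC_alg \<sigma>)) (inv_into (AC \<sigma>) \<Phi>)"
    using assms(1) unfolding banach_alg_iso_def AC_alg_sel by blast
  obtain \<Psi> where bij2: "bij_betw \<Psi> (AC \<tau>) (AC \<upsilon>)"
    and hom2: "\<And>f g. f \<in> AC \<tau> \<Longrightarrow> g \<in> AC \<tau> \<Longrightarrow> \<Psi> (\<lambda>z. f z + g z) = (\<lambda>z. \<Psi> f z + \<Psi> g z)"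
      "\<And>a f. f \<in> AC \<tau> \<Longrightarrow> \<Psi> (\<lambda>z. a * f z) = (\<lambda>z. a * \<Psi> f z)"
      "\<And>f g. f \<in> AC \<tau> \<Longrightarrow> g \<in> AC \<tau> \<Longrightarrow> \<Psi> (\<lambda>z. f z * g z) = (\<lambda>z. \<Psi> f z * \<Psi> g z)"
    and cont2: "continuous_map (norm_topology (AC_alg \<tau>)) (norm_topology (AC_alg \<upsilon>)) \<Psi>"
      "continuous_map (norm_topology (AC_alg \<upsilon>)) (norm_topology (AC_alg \<tau>)) (inv_into (AC \<tau>) \<Psi>)"
    using assms(2) unfolding banach_alg_iso_def AC_alg_sel by blast
  have in_AC: "\<Phi> f \<in> AC \<tau>" if "f \<in> AC \<sigma>" for f using bij1 that by (auto dest: bij_betwE)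
  have bij: "bij_betw (\<Psi> \<circ> \<Phi>) (AC \<sigma>) (AC \<upsilon>)" by (rule bij_betw_trans[OF bij1 bij2])
  have inv: "(inv_into (AC \<sigma>) \<Phi> \<circ> inv_into (AC \<tau>) \<Psi>) f = inv_into (AC \<sigma>) (\<Psi> \<circ> \<Phi>) f"
    if "f \<in> AC \<upsilon>" for f
  proof -
    obtain g where g: "g \<in> AC \<sigma>" "f = \<Psi> (\<Phi> g)" using bij \<open>f \<in> AC \<upsilon>\<close> by (auto simp: bij_betw_def)
    then show ?thesis
      using bij_betw_inv_into_left[OF bij1 g(1)] bij_betw_inv_into_left[OF bij2 in_AC[OF g(1)]]
        bij_betw_inv_into_left[OF bij g(1)] by simp
  qed
  show ?thesis unfolding banach_alg_iso_def AC_alg_sel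
    using bij continuous_map_compose[OF cont1(1) cont2(1)]
      continuous_map_eq[OF continuous_map_compose[OF cont2(2) cont1(2)] inv]
    by (intro exI[of _ "\<Psi> \<circ> \<Phi>"]) (simp add: hom1 hom2 in_AC)
qed

section \<open>Composition with almost monotone bijections\<close>

lemma cvar_Cons_le:
  assumes "\<And>z. z \<in> set (x # T) \<Longrightarrow> norm (f z) \<le> A"
  shows "cvar f (x # T) \<le> 2 * A + cvar f T"
proof (cases T)
  case Nil
  then show ?thesis using order_trans[OF norm_ge_zero assms[of x]] by simp
next
  case (Cons y T')
  then show ?thesis using assms[of x] assms[of y] norm_triangle_ineq4[of "f y" "f x"] by simp
qed

lemma cvar_le_Cons: "cvar f T \<le> cvar f (x # T)"
  by (cases T) auto

text \<open>Removing one point from a list changes at most two steps, each of size at most \<open>2 * A\<close>.\<close>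

lemma cvar_filter:
  assumes "\<And>z. z \<in> set T \<Longrightarrow> norm (f z) \<le> A"
  shows "cvar f T \<le> cvar f (filter P T) + 4 * A * length (filter (\<lambda>z. \<not> P z) T)"
proof -
  \<comment> \<open>a removed head spoils only one step; the saved \<open>2 * A\<close> pays
    for the step into it from an earlier kept point\<close>
  have "cvar f T \<le> cvar f (filter P T) + 4 * A * length (filter (\<lambda>z. \<not> P z) T)
      - (if T \<noteq> [] \<and> \<not> P (hd T) then 2 * A else 0)"
    using assms
  proof (induction T)
    case (Cons x T)
    have A: "0 \<le> A" using order_trans[OF norm_ge_zero Cons.prems[of x]] by simp
    have IH: "cvar f T \<le> cvar f (filter P T) + 4 * A * length (filter (\<lambda>z. \<not> P z) T)
      - (if T \<noteq> [] \<and> \<not> P (hd T) then 2 * A else 0)"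
      using Cons by auto
    show ?case
    proof (cases "P x")
      case False
      then show ?thesis using IH cvar_Cons_le[of x T f A] Cons.prems A by (auto simp: algebra_simps split: if_splits)
    next
      case True
      show ?thesis
      proof (cases T)
        case (Cons y T')
        show ?thesis
        proof (cases "P y")
          case False
          then show ?thesis
            using IH cvar_Cons_le[of x T f A] Cons.prems True \<open>T = y # T'\<close> cvar_le_Cons[of f "filter P T'" x] by auto
        qed (use IH True \<open>T = y # T'\<close> in auto)
      qed (use True in auto)
    qed
  qed auto
  moreover have "0 \<le> A" if "T \<noteq> []"
    using order_trans[OF norm_ge_zero assms[of "hd T"]] that by simp
  ultimately show ?thesis by (auto split: if_splits)
qed

lemma directed_list_distinct: "directed_list s T \<Longrightarrow> distinct T"
  unfolding directed_list_def by (induction T) auto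

text \<open>Off the exceptional set \<open>F\<close> the map \<open>h\<close> sends directed lists to directed lists; the points of \<open>F\<close>
  occur at most once each in a directed list, and are dropped from it at a bounded cost.\<close>

lemma bv_bound_reparametrize:
  fixes B :: real
  assumes f: "bv_bound \<tau> f B" and h: "h ` \<sigma> \<subseteq> \<tau>" and F: "finite F"
    and sign: "s \<in> {1, -1}" "t \<in> {1, -1}"
    and mono: "\<And>x y. x \<in> \<sigma> - F \<Longrightarrow> y \<in> \<sigma> - F \<Longrightarrow> s * Re x < s * Re y \<Longrightarrow> t * Re (h x) < t * Re (h y)"
  shows "bv_bound \<sigma> (\<lambda>z. f (h z)) ((1 + 4 * card F) * B)"
proof (rule bv_boundI_directed[OF sign(1)])
  have B: "0 \<le> B" by (rule bv_bound_nonneg[OF f])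
  have norm: "norm (f (h z)) \<le> B" if "z \<in> \<sigma>" for z using that h by (intro bv_bound_norm[OF f]) auto
  show "norm (f (h z)) \<le> (1 + 4 * card F) * B" if "z \<in> \<sigma>" for z
    using norm[OF that] B by (simp add: distrib_right add_increasing2)
  fix T assume T: "directed_list s T" "set T \<subseteq> \<sigma>"
  let ?T = "filter (\<lambda>z. z \<notin> F) T"
  have "sorted_wrt (\<lambda>x y. s * Re x < s * Re y) ?T"
    using T(1) unfolding directed_list_def by (rule sorted_wrt_filter)
  then have "directed_list t (map h ?T)"
    unfolding directed_list_def sorted_wrt_map
    by (rule sorted_wrt_mono_rel[rotated]) (use mono T(2) in auto)
  then have "cvar f (map h ?T) \<le> B"
    using T(2) h by (intro bv_bound_cvar[OF f _ sign(2)]) auto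
  also have "cvar f (map h ?T) = cvar (\<lambda>z. f (h z)) ?T" by (simp add: cvar_def)
  finally have 1: "cvar (\<lambda>z. f (h z)) ?T \<le> B" .
  have "length (filter (\<lambda>z. \<not> z \<notin> F) T) = card (F \<inter> set T)"
    using distinct_length_filter[OF directed_list_distinct[OF T(1)], of "\<lambda>z. z \<in> F"] by simp
  also have "\<dots> \<le> card F" using F by (intro card_mono) auto
  finally have 2: "4 * B * length (filter (\<lambda>z. \<not> z \<notin> F) T) \<le> 4 * B * card F"
    using B by (intro mult_left_mono) auto
  have "cvar (\<lambda>z. f (h z)) T \<le> cvar (\<lambda>z. f (h z)) ?T + 4 * B * length (filter (\<lambda>z. \<not> z \<notin> F) T)"
    using norm T(2) by (intro cvar_filter) auto
  with 1 2 show "cvar (\<lambda>z. f (h z)) T \<le> (1 + 4 * card F) * B"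
    by (simp add: algebra_simps)
qed

definition pullback :: "complex set \<Rightarrow> (complex \<Rightarrow> complex) \<Rightarrow> (complex \<Rightarrow> complex) \<Rightarrow> complex \<Rightarrow> complex" where
  "pullback \<sigma> h f = (\<lambda>z. if z \<in> \<sigma> then f (h z) else 0)"

text \<open>Continuity of \<open>h\<close> at \<open>0\<close> is automatic: by injectivity only finitely many points are mapped
  outside a given neighbourhood of \<open>0\<close>.\<close>

lemma pullback_const_near_zero:
  assumes \<sigma>: "real_C_set \<sigma>" and \<tau>: "real_C_set \<tau>"
    and h: "h ` \<sigma> \<subseteq> \<tau>" "inj_on h \<sigma>" "h 0 = 0" and g: "g \<in> const_near_zero \<tau>"
  shows "pullback \<sigma> h g \<in> const_near_zero \<sigma>"
proof -
  obtain d where d: "d > 0" "\<And>z. z \<in> \<tau> \<Longrightarrow> norm z < d \<Longrightarrow> g z = g 0"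
    using g by (auto simp: const_near_zero_def)
  have "finite (h -` {z\<in>\<tau>. d \<le> norm z} \<inter> \<sigma>)"
    by (rule finite_vimage_IntI[OF real_C_set_finite_away[OF \<tau> d(1)] h(2)])
  from finite_set_avoid[OF this, of 0]
  obtain e where e: "e > 0" "\<And>z. z \<in> h -` {z\<in>\<tau>. d \<le> norm z} \<inter> \<sigma> \<Longrightarrow> z \<noteq> 0 \<Longrightarrow> e \<le> norm z"
    by auto
  have "pullback \<sigma> h g z = pullback \<sigma> h g 0" if "z \<in> \<sigma>" "norm z < e" for z
  proof (cases "z = 0")
    case False
    have hz: "h z \<in> \<tau>" using h(1) that(1) by blast
    have "\<not> d \<le> norm (h z)"
    proof
      assume "d \<le> norm (h z)"
      then have "z \<in> h -` {z\<in>\<tau>. d \<le> norm z} \<inter> \<sigma>" using that(1) hz by simp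
      from e(2)[OF this False] that(2) show False by simp
    qed
    then have "g (h z) = g 0" using hz by (intro d(2)) simp_all
    then show ?thesis using that(1) h(3) real_C_set_zero_mem[OF \<sigma>] by (simp add: pullback_def)
  qed simp
  moreover have "pullback \<sigma> h g z = 0" if "z \<notin> \<sigma>" for z using that by (simp add: pullback_def)
  ultimately show ?thesis using e(1) unfolding const_near_zero_def by blast
qed

lemma pullback_AC:
  assumes \<sigma>: "real_C_set \<sigma>" and \<tau>: "real_C_set \<tau>"
    and h: "h ` \<sigma> \<subseteq> \<tau>" "inj_on h \<sigma>" "h 0 = 0" and f: "f \<in> AC \<tau>" and K: "K > 0"
    and bound: "\<And>f B. bv_bound \<tau> f B \<Longrightarrow> bv_bound \<sigma> (\<lambda>z. f (h z)) (K * B)"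
  shows "pullback \<sigma> h f \<in> AC \<sigma>"
proof -
  have "\<exists>g\<in>const_near_zero \<sigma>. bv_bound \<sigma> (\<lambda>z. pullback \<sigma> h f z - g z) e" if e: "e > 0" for e
  proof -
    have "e / K > 0" using e K by simp
    then obtain g where g: "g \<in> const_near_zero \<tau>" "bv_bound \<tau> (\<lambda>z. f z - g z) (e / K)"
      using f by (auto simp: AC_eq_bv_closure[OF \<tau>] bv_closure_def)
    have "bv_bound \<sigma> (\<lambda>z. f (h z) - g (h z)) e" using bound[OF g(2)] K by simp
    then have "bv_bound \<sigma> (\<lambda>z. pullback \<sigma> h f z - pullback \<sigma> h g z) e"
      by (rule bv_bound_cong[rotated]) (simp add: pullback_def)
    then show ?thesis using pullback_const_near_zero[OF \<sigma> \<tau> h g(1)] by blast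
  qed
  then show ?thesis by (simp add: AC_eq_bv_closure[OF \<sigma>] bv_closure_def pullback_def)
qed

lemma banach_alg_iso_reparametrize:
  assumes \<sigma>: "real_C_set \<sigma>" and \<tau>: "real_C_set \<tau>"
    and h: "bij_betw h \<sigma> \<tau>" "h 0 = 0" and F: "finite F"
    and sign: "s \<in> {1, -1}" "t \<in> {1, -1}"
    and mono: "\<And>x y. x \<in> \<sigma> - F \<Longrightarrow> y \<in> \<sigma> - F \<Longrightarrow> s * Re x < s * Re y \<Longrightarrow> t * Re (h x) < t * Re (h y)"
  shows "banach_alg_iso (AC_alg \<tau>) (AC_alg \<sigma>)"
proof -
  define k where "k = inv_into \<sigma> h"
  note zero = real_C_set_zero_mem[OF \<sigma>] real_C_set_zero_mem[OF \<tau>]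
  have k: "bij_betw k \<tau> \<sigma>" unfolding k_def by (rule bij_betw_inv_into[OF h(1)])
  have kh: "k (h x) = x" if "x \<in> \<sigma>" for x
    unfolding k_def by (rule bij_betw_inv_into_left[OF h(1) that])
  have hk: "h (k y) = y" if "y \<in> \<tau>" for y
    unfolding k_def by (rule bij_betw_inv_into_right[OF h(1) that])
  have k0: "k 0 = 0" using kh[of 0] zero h(2) by simp
  have hmem: "h x \<in> \<tau>" if "x \<in> \<sigma>" for x using h(1) that by (auto dest: bij_betwE)
  have kmem: "k y \<in> \<sigma>" if "y \<in> \<tau>" for y using k that by (auto dest: bij_betwE)
  have mono': "s * Re (k u) < s * Re (k v)"
    if uv: "u \<in> \<tau> - h ` F" "v \<in> \<tau> - h ` F" "t * Re u < t * Re v" for u v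
  proof -
    have mem: "k u \<in> \<sigma> - F" "k v \<in> \<sigma> - F" using uv kmem hk by (auto simp: image_iff)
    have hku: "h (k u) = u" and hkv: "h (k v) = v" using hk uv(1,2) by blast+
    have "u \<noteq> v" using uv(3) by blast
    then have "k u \<noteq> k v" using hku hkv by metis
    then have "Re (k u) \<noteq> Re (k v)"
      using Re_less_trichotomy[of "k u" "k v"] mem real_C_set_subset_Reals[OF \<sigma>] by (auto simp: subset_iff)
    moreover have "\<not> s * Re (k v) < s * Re (k u)"
      using mono[OF mem(2,1)] uv(3) unfolding hku hkv by linarith
    ultimately show ?thesis using sign(1) by auto
  qed
  define K where "K = 1 + 4 * real (card F + card (h ` F))"
  have K: "K > 0" by (simp add: K_def)
  have hbound: "bv_bound \<sigma> (\<lambda>z. f (h z)) (K * B)" if f: "bv_bound \<tau> f B" for f B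
  proof (rule bv_bound_mono)
    show "bv_bound \<sigma> (\<lambda>z. f (h z)) ((1 + 4 * card F) * B)"
      by (rule bv_bound_reparametrize[OF f _ F sign mono]) (use hmem in auto)
    show "(1 + 4 * card F) * B \<le> K * B"
      unfolding K_def by (rule mult_right_mono[OF _ bv_bound_nonneg[OF f]]) simp
  qed
  have kbound: "bv_bound \<tau> (\<lambda>z. f (k z)) (K * B)" if f: "bv_bound \<sigma> f B" for f B
  proof (rule bv_bound_mono)
    show "bv_bound \<tau> (\<lambda>z. f (k z)) ((1 + 4 * card (h ` F)) * B)"
      by (rule bv_bound_reparametrize[OF f _ finite_imageI[OF F] sign(2,1) mono']) (use kmem in auto)
    show "(1 + 4 * card (h ` F)) * B \<le> K * B"
      unfolding K_def by (rule mult_right_mono[OF _ bv_bound_nonneg[OF f]]) simp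
  qed
  let ?\<Phi> = "pullback \<sigma> h" and ?\<Psi> = "pullback \<tau> k"
  have \<Phi>: "?\<Phi> f \<in> AC \<sigma>" if "f \<in> AC \<tau>" for f
    using h that by (intro pullback_AC[OF \<sigma> \<tau> _ _ _ _ K hbound]) (auto simp: bij_betw_def)
  have \<Psi>: "?\<Psi> f \<in> AC \<tau>" if "f \<in> AC \<sigma>" for f
    using k k0 that by (intro pullback_AC[OF \<tau> \<sigma> _ _ _ _ K kbound]) (auto simp: bij_betw_def)
  have \<Psi>\<Phi>: "?\<Psi> (?\<Phi> f) = f" if "f \<in> AC \<tau>" for f
    using AC_zero_outside[OF that] by (auto simp: pullback_def kmem hk)
  have \<Phi>\<Psi>: "?\<Phi> (?\<Psi> f) = f" if "f \<in> AC \<sigma>" for f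
    using AC_zero_outside[OF that] by (auto simp: pullback_def hmem kh)
  have bij: "bij_betw ?\<Phi> (AC \<tau>) (AC \<sigma>)"
    by (rule bij_betw_byWitness[of _ ?\<Psi>]) (use \<Phi> \<Psi> \<Psi>\<Phi> \<Phi>\<Psi> in auto)
  have inv: "?\<Psi> f = inv_into (AC \<tau>) ?\<Phi> f" if "f \<in> AC \<sigma>" for f
    using bij_betw_inv_into_left[OF bij \<Psi>[OF that]] \<Phi>\<Psi>[OF that] by simp
  have cont: "continuous_map (norm_topology (AC_alg \<tau>)) (norm_topology (AC_alg \<sigma>)) ?\<Phi>"
    by (rule continuous_map_AC[OF \<tau> \<sigma> \<Phi> _ _ K])
      (auto simp: pullback_def intro: bv_bound_cong[OF _ hbound])
  have "continuous_map (norm_topology (AC_alg \<sigma>)) (norm_topology (AC_alg \<tau>)) ?\<Psi>"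
    by (rule continuous_map_AC[OF \<sigma> \<tau> \<Psi> _ _ K])
      (auto simp: pullback_def intro: bv_bound_cong[OF _ kbound])
  then have "continuous_map (norm_topology (AC_alg \<sigma>)) (norm_topology (AC_alg \<tau>)) (inv_into (AC \<tau>) ?\<Phi>)"
    by (rule continuous_map_eq) (simp add: inv)
  with bij cont show ?thesis
    unfolding banach_alg_iso_def by (intro exI[of _ ?\<Phi>]) (auto simp: pullback_def)
qed

section \<open>One-sided and two-sided sets\<close>

text \<open>The rank of \<open>x\<close> is the number of points with smaller key.  It is strictly monotone, and its range
  is downward closed, since the predecessor of a point of rank \<open>n + 1\<close> has rank \<open>n\<close>.\<close>

lemma rank_enumerates:
  fixes \<kappa> :: "'a \<Rightarrow> real"
  assumes inf: "infinite A" and inj: "inj_on \<kappa> A" and fin: "\<And>b. finite {y\<in>A. \<kappa> y \<le> b}"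
  obtains r :: "'a \<Rightarrow> nat" where "bij_betw r A UNIV"
    "\<And>x y. x \<in> A \<Longrightarrow> y \<in> A \<Longrightarrow> \<kappa> x < \<kappa> y \<Longrightarrow> r x < r y"
proof -
  define below where "below x = {y\<in>A. \<kappa> y < \<kappa> x}" for x
  define r where "r x = card (below x)" for x
  have finb: "finite (below x)" for x
    by (rule finite_subset[OF _ fin[of "\<kappa> x"]]) (auto simp: below_def)
  have less: "r x < r y" if "x \<in> A" "y \<in> A" "\<kappa> x < \<kappa> y" for x y
    unfolding r_def by (rule psubset_card_mono[OF finb]) (use that in \<open>auto simp: below_def\<close>)
  have inj_r: "inj_on r A"
  proof (rule inj_onI)
    fix x y assume "x \<in> A" "y \<in> A" "r x = r y"
    then show "x = y"
      using less[of x y] less[of y x]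
      by (cases "\<kappa> x" "\<kappa> y" rule: linorder_cases) (auto dest: inj_onD[OF inj])
  qed
  have pred: "n \<in> r ` A" if "Suc n \<in> r ` A" for n
  proof -
    obtain x where x: "x \<in> A" "r x = Suc n" using \<open>Suc n \<in> r ` A\<close> by auto
    then have "below x \<noteq> {}" by (auto simp: r_def)
    then have "Max (\<kappa> ` below x) \<in> \<kappa> ` below x" using finb[of x] by (intro Max_in) auto
    then obtain y where y: "y \<in> below x" "\<kappa> y = Max (\<kappa> ` below x)" by force
    have le: "\<kappa> z \<le> \<kappa> y" if "z \<in> below x" for z
      unfolding y(2) using finb[of x] that by (intro Max_ge) auto
    have yA: "y \<in> A" using y(1) by (simp add: below_def)
    have "\<kappa> z \<noteq> \<kappa> y" if "z \<in> A" "z \<noteq> y" for z using inj_onD[OF inj _ that(1) yA] that by blast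
    then have "z \<in> below y \<longleftrightarrow> z \<in> below x - {y}" for z
      using y(1) le[of z] by (fastforce simp: below_def)
    then have "below y = below x - {y}" by blast
    then have "r y = n" using x y(1) finb[of x] by (simp add: r_def)
    then show ?thesis using yA by blast
  qed
  have down: "n \<in> r ` A" if "m \<in> r ` A" "n \<le> m" for m n
    using that(2,1) by (induction rule: inc_induct) (auto intro: pred)
  have "infinite (r ` A)" using inf inj_r by (simp add: finite_image_iff)
  then have "r ` A = UNIV" using down by (auto simp: infinite_nat_iff_unbounded_le) blast
  then show ?thesis using that inj_r less by (simp add: bij_betw_def)
qed

lemma order_iso_of_keys:
  fixes \<kappa> :: "'a \<Rightarrow> real" and \<mu> :: "'b \<Rightarrow> real"
  assumes "infinite A" "inj_on \<kappa> A" "\<And>b. finite {y\<in>A. \<kappa> y \<le> b}"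
    and "infinite B" "inj_on \<mu> B" "\<And>b. finite {y\<in>B. \<mu> y \<le> b}"
  obtains h where "bij_betw h A B" "\<And>x y. x \<in> A \<Longrightarrow> y \<in> A \<Longrightarrow> \<kappa> x < \<kappa> y \<Longrightarrow> \<mu> (h x) < \<mu> (h y)"
proof -
  obtain r :: "'a \<Rightarrow> nat" where r: "bij_betw r A UNIV" "\<And>x y. x \<in> A \<Longrightarrow> y \<in> A \<Longrightarrow> \<kappa> x < \<kappa> y \<Longrightarrow> r x < r y"
    using rank_enumerates assms(1-3) by blast
  obtain q :: "'b \<Rightarrow> nat" where q: "bij_betw q B UNIV" "\<And>x y. x \<in> B \<Longrightarrow> y \<in> B \<Longrightarrow> \<mu> x < \<mu> y \<Longrightarrow> q x < q y"
    using rank_enumerates assms(4-6) by blast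
  define h where "h = inv_into B q \<circ> r"
  have h: "bij_betw h A B" unfolding h_def by (rule bij_betw_trans[OF r(1) bij_betw_inv_into[OF q(1)]])
  have qh: "q (h x) = r x" for x by (simp add: h_def bij_betw_inv_into_right[OF q(1)])
  have "\<mu> (h x) < \<mu> (h y)" if xy: "x \<in> A" "y \<in> A" "\<kappa> x < \<kappa> y" for x y
  proof (rule ccontr)
    have mem: "h x \<in> B" "h y \<in> B" using h xy by (auto dest: bij_betwE)
    have *: "q (h x) < q (h y)" using r(2)[OF xy] by (simp add: qh)
    assume "\<not> \<mu> (h x) < \<mu> (h y)"
    then show False
      using q(2)[OF mem(2,1)] * inj_onD[OF assms(5) _ mem] by (cases "\<mu> (h x) = \<mu> (h y)") auto
  qed
  then show ?thesis using that h by blast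
qed

definition side :: "real \<Rightarrow> complex set \<Rightarrow> complex set" where
  "side s \<sigma> = {z\<in>\<sigma>. 0 < s * Re z}"

lemma inj_on_key: "\<sigma> \<subseteq> \<real> \<Longrightarrow> s \<noteq> 0 \<Longrightarrow> inj_on (\<lambda>z. s / Re z) \<sigma>"
  by (auto simp: inj_on_def complex_eq_iff complex_is_Real_iff subset_iff divide_inverse)

text \<open>The key \<open>s / x\<close> puts the points on the wrong side first and then runs through the others in the
  direction of \<open>0\<close>, which gives a one-sided set without \<open>0\<close> the order type \<open>\<nat>\<close>.\<close>

lemma finite_key_le:
  assumes \<sigma>: "real_C_set \<sigma>" and s: "s \<in> {1, -1}" and A: "A \<subseteq> \<sigma> - {0}" and fin: "finite (side (- s) A)"
  shows "finite {z\<in>A. s / Re z \<le> b}"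
proof (rule finite_subset)
  define c where "c = max b 1"
  have c: "c > 0" "b \<le> c" by (auto simp: c_def)
  show "{z\<in>A. s / Re z \<le> b} \<subseteq> side (- s) A \<union> {z\<in>\<sigma>. 1 / c \<le> norm z}"
  proof
    fix z assume z: "z \<in> {z\<in>A. s / Re z \<le> b}"
    then have "z \<in> \<sigma>" "z \<noteq> 0" using A by auto
    then have Re: "Re z \<noteq> 0" using real_C_set_subset_Reals[OF \<sigma>]
      by (auto simp: complex_eq_iff complex_is_Real_iff)
    show "z \<in> side (- s) A \<union> {z\<in>\<sigma>. 1 / c \<le> norm z}"
    proof (cases "0 < s * Re z")
      case True
      then have "s / Re z = 1 / \<bar>Re z\<bar>" using s by (auto simp: abs_if)
      then have "1 / \<bar>Re z\<bar> \<le> c" using z c by auto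
      then have "1 / c \<le> \<bar>Re z\<bar>" using Re c by (simp add: field_simps)
      then have "1 / c \<le> norm z" using abs_Re_le_cmod[of z] by linarith
      then show ?thesis using \<open>z \<in> \<sigma>\<close> by simp
    qed (use z Re s in \<open>auto simp: side_def\<close>)
  qed
  show "finite (side (- s) A \<union> {z\<in>\<sigma>. 1 / c \<le> norm z})"
    using fin real_C_set_finite_away[OF \<sigma>, of "1 / c"] c by simp
qed

definition one_sided :: "real \<Rightarrow> complex set \<Rightarrow> bool" where
  "one_sided s \<sigma> \<longleftrightarrow> s \<in> {1, -1} \<and> infinite (side s \<sigma>) \<and> finite (side (- s) \<sigma>)"

definition two_sided :: "complex set \<Rightarrow> bool" where
  "two_sided \<sigma> \<longleftrightarrow> infinite (side 1 \<sigma>) \<and> infinite (side (- 1) \<sigma>)"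

lemma real_C_set_sides:
  assumes "real_C_set \<sigma>"
  shows "\<sigma> = side 1 \<sigma> \<union> side (- 1) \<sigma> \<union> {0}"
  using real_C_set_zero_mem[OF assms] real_C_set_subset_Reals[OF assms]
  by (auto simp: side_def complex_eq_iff complex_is_Real_iff)

lemma one_or_two_sided:
  assumes "real_C_set \<sigma>"
  shows "two_sided \<sigma> \<or> (\<exists>s. one_sided s \<sigma>)"
proof -
  have "infinite \<sigma>" using assms by (simp add: real_C_set_def C_set_def)
  then have "infinite (side 1 \<sigma>) \<or> infinite (side (- 1) \<sigma>)"
    using real_C_set_sides[OF assms] by (metis finite.emptyI finite.insertI finite_UnI)
  then show ?thesis by (force simp: two_sided_def one_sided_def)
qed

text \<open>Match the enumerations by the key \<open>s / x\<close>.  The matching can fail to be monotone only at points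
  that lie on the wrong side themselves or are mapped to the wrong side, and these are finitely many.\<close>

lemma one_sided_iso:
  assumes \<sigma>: "real_C_set \<sigma>" and \<tau>: "real_C_set \<tau>" and s: "one_sided s \<sigma>" and t: "one_sided t \<tau>"
  shows "banach_alg_iso (AC_alg \<tau>) (AC_alg \<sigma>)"
proof -
  have sign: "s \<in> {1, -1}" "t \<in> {1, -1}" using s t by (auto simp: one_sided_def)
  have fin_side: "finite (side (- r) (\<upsilon> - {0}))" if "one_sided r \<upsilon>" for r \<upsilon>
    by (rule finite_subset[of _ "side (- r) \<upsilon>"]) (use that in \<open>auto simp: side_def one_sided_def\<close>)
  have inf: "infinite (\<upsilon> - {0})" if "real_C_set \<upsilon>" for \<upsilon>
    using that by (simp add: real_C_set_def C_set_def)
  have inj: "inj_on (\<lambda>z. r / Re z) (\<upsilon> - {0})" if "real_C_set \<upsilon>" "r \<in> {1, -1}" for \<upsilon> r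
    using that real_C_set_subset_Reals[of \<upsilon>] by (intro inj_on_key) auto
  obtain p where p: "bij_betw p (\<sigma> - {0}) (\<tau> - {0})"
    "\<And>x y. x \<in> \<sigma> - {0} \<Longrightarrow> y \<in> \<sigma> - {0} \<Longrightarrow> s / Re x < s / Re y \<Longrightarrow> t / Re (p x) < t / Re (p y)"
    by (rule order_iso_of_keys[OF inf[OF \<sigma>] inj[OF \<sigma> sign(1)] finite_key_le[OF \<sigma> sign(1) order_refl fin_side[OF s]]
          inf[OF \<tau>] inj[OF \<tau> sign(2)] finite_key_le[OF \<tau> sign(2) order_refl fin_side[OF t]]]) blast
  define h where "h = p(0 := 0)"
  have "bij_betw h ((\<sigma> - {0}) \<union> {0}) ((\<tau> - {0}) \<union> {0})"
    using p(1) by (intro bij_betw_combine) (auto simp: h_def bij_betw_def inj_on_def)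
  moreover have "(\<sigma> - {0}) \<union> {0} = \<sigma>" "(\<tau> - {0}) \<union> {0} = \<tau>"
    using real_C_set_zero_mem[OF \<sigma>] real_C_set_zero_mem[OF \<tau>] by auto
  ultimately have bij: "bij_betw h \<sigma> \<tau>" by simp
  define F where "F = side (- s) \<sigma> \<union> (h -` side (- t) \<tau> \<inter> \<sigma>)"
  have F: "finite F"
    using s t bij by (auto simp: F_def one_sided_def bij_betw_def intro: finite_vimage_IntI)
  have nonneg: "0 \<le> s * Re x" "0 \<le> t * Re (h x)" if "x \<in> \<sigma> - F" for x
    using that bij_betwE[OF bij] by (auto simp: F_def side_def not_less)
  have h0: "h x \<noteq> 0" if "x \<in> \<sigma>" "x \<noteq> 0" for x using that p(1) by (auto simp: h_def bij_betw_def)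
  have Re0: "Re x \<noteq> 0" if "x \<in> \<upsilon>" "x \<noteq> 0" "real_C_set \<upsilon>" for x \<upsilon>
    using that real_C_set_subset_Reals[of \<upsilon>] by (auto simp: complex_eq_iff complex_is_Real_iff)
  show ?thesis
  proof (rule banach_alg_iso_reparametrize[OF \<sigma> \<tau> bij _ F sign])
    fix x y assume x: "x \<in> \<sigma> - F" and y: "y \<in> \<sigma> - F" and less: "s * Re x < s * Re y"
    have y0: "y \<noteq> 0" "0 < s * Re y" using nonneg(1)[OF x] less by auto
    then have "Re (h y) \<noteq> 0" using y h0[of y] bij_betwE[OF bij] by (intro Re0[OF _ _ \<tau>]) auto
    then have hy: "0 < t * Re (h y)" using nonneg(2)[OF y] sign by auto
    show "t * Re (h x) < t * Re (h y)"
    proof (cases "x = 0")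
      case True
      then show ?thesis using hy by (simp add: h_def)
    next
      case False
      then have x0: "0 < s * Re x" using nonneg(1)[OF x] Re0[of x \<sigma>] \<sigma> x sign by force
      have "Re (h x) \<noteq> 0" using False x h0[of x] bij_betwE[OF bij] by (intro Re0[OF _ _ \<tau>]) auto
      then have hx: "0 < t * Re (h x)" using nonneg(2)[OF x] sign by auto
      have inv: "r / c = 1 / (r * c)" if "r \<in> {1, -1}" for r c :: real using that by auto
      have "s / Re y < s / Re x" unfolding inv[OF sign(1)] using x0 less by (simp add: frac_less2)
      then have "t / Re (h y) < t / Re (h x)" using p(2)[of y x] x y y0 False by (simp add: h_def)
      then have "inverse (t * Re (h y)) < inverse (t * Re (h x))"
        unfolding inv[OF sign(2)] by (simp only: inverse_eq_divide)
      then show ?thesis using hy by (rule inverse_less_imp_less)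
    qed
  qed (simp add: h_def)
qed

text \<open>Matching the positive halves and the negative halves separately, each outside in, gives an
  increasing bijection.\<close>

lemma two_sided_iso:
  assumes \<sigma>: "real_C_set \<sigma>" and \<tau>: "real_C_set \<tau>" and "two_sided \<sigma>" "two_sided \<tau>"
  shows "banach_alg_iso (AC_alg \<tau>) (AC_alg \<sigma>)"
proof -
  have half: "\<exists>p. bij_betw p (side s \<sigma>) (side s \<tau>) \<and>
      (\<forall>x\<in>side s \<sigma>. \<forall>y\<in>side s \<sigma>. s / Re x < s / Re y \<longrightarrow> s / Re (p x) < s / Re (p y))"
    if s: "s \<in> {1, -1}" for s
  proof -
    have empty: "side (- s) (side s \<upsilon>) = {}" for \<upsilon> by (auto simp: side_def)
    have inf: "infinite (side s \<sigma>)" "infinite (side s \<tau>)" using assms s by (auto simp: two_sided_def)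
    have inj: "inj_on (\<lambda>z. s / Re z) (side s \<upsilon>)" if "real_C_set \<upsilon>" for \<upsilon>
      using real_C_set_subset_Reals[OF that] s by (intro inj_on_key) (auto simp: side_def)
    have fin: "finite {z\<in>side s \<upsilon>. s / Re z \<le> b}" if "real_C_set \<upsilon>" for \<upsilon> b
      using that s by (rule finite_key_le) (simp_all add: empty, auto simp: side_def)
    show ?thesis
      by (rule order_iso_of_keys[OF inf(1) inj[OF \<sigma>] fin[OF \<sigma>] inf(2) inj[OF \<tau>] fin[OF \<tau>]]) blast
  qed
  obtain p where p: "bij_betw p (side 1 \<sigma>) (side 1 \<tau>)"
    "\<And>x y. x \<in> side 1 \<sigma> \<Longrightarrow> y \<in> side 1 \<sigma> \<Longrightarrow> 1 / Re x < 1 / Re y \<Longrightarrow> 1 / Re (p x) < 1 / Re (p y)"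
    using half[of 1] by auto
  obtain q where q: "bij_betw q (side (- 1) \<sigma>) (side (- 1) \<tau>)"
    "\<And>x y. x \<in> side (- 1) \<sigma> \<Longrightarrow> y \<in> side (- 1) \<sigma> \<Longrightarrow> - 1 / Re x < - 1 / Re y \<Longrightarrow> - 1 / Re (q x) < - 1 / Re (q y)"
    using half[of "- 1"] by auto
  define h where "h z = (if z \<in> side 1 \<sigma> then p z else if z \<in> side (- 1) \<sigma> then q z else 0)" for z
  have "bij_betw (\<lambda>z. if z \<in> side (- 1) \<sigma> then q z else 0) (side (- 1) \<sigma> \<union> {0}) (side (- 1) \<tau> \<union> {0})"
    by (rule bij_betw_disjoint_Un[OF q(1)]) (auto simp: side_def bij_betw_def)
  with p(1) have "bij_betw h (side 1 \<sigma> \<union> (side (- 1) \<sigma> \<union> {0})) (side 1 \<tau> \<union> (side (- 1) \<tau> \<union> {0}))"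
    unfolding h_def by (rule bij_betw_disjoint_Un) (auto simp: side_def)
  then have bij: "bij_betw h \<sigma> \<tau>"
    using real_C_set_sides[OF \<sigma>] real_C_set_sides[OF \<tau>] by (simp add: Un_assoc)
  have pos: "h z \<in> side 1 \<tau> \<and> h z = p z" if "z \<in> side 1 \<sigma>" for z
    using that bij_betwE[OF p(1)] by (auto simp: h_def)
  have neg: "h z \<in> side (- 1) \<tau> \<and> h z = q z" if "z \<in> side (- 1) \<sigma>" for z
    using that bij_betwE[OF q(1)] by (auto simp: h_def side_def)
  have h0: "h 0 = 0" by (simp add: h_def side_def)
  show ?thesis
  proof (rule banach_alg_iso_reparametrize[where F = "{}" and s = 1 and t = 1, OF \<sigma> \<tau> bij h0])
    fix x y assume x: "x \<in> \<sigma> - {}" and y: "y \<in> \<sigma> - {}" and less: "1 * Re x < 1 * Re y"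
    consider "x \<in> side 1 \<sigma>" "y \<in> side 1 \<sigma>" | "x \<in> side (- 1) \<sigma>" "y \<in> side (- 1) \<sigma>"
      | "x \<in> side (- 1) \<sigma> \<union> {0}" "y \<in> side 1 \<sigma> \<union> {0}"
      using x y less real_C_set_sides[OF \<sigma>] by (auto simp: side_def)
    then show "1 * Re (h x) < 1 * Re (h y)"
    proof cases
      case 1
      then have "1 / Re y < 1 / Re x" using less by (simp add: side_def frac_less2)
      then show ?thesis using p(2)[of y x] pos[of x] pos[of y] 1 by (auto simp: side_def field_simps)
    next
      case 2
      then have "- 1 / Re x < - 1 / Re y" using less by (auto simp: side_def divide_simps)
      then show ?thesis using q(2)[of x y] neg[of x] neg[of y] 2 by (auto simp: side_def divide_simps split: if_splits)
    next
      case 3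
      then have "Re (h x) \<le> 0" "0 \<le> Re (h y)" "Re (h x) < 0 \<or> 0 < Re (h y)"
        using neg[of x] pos[of y] h0 less by (auto simp: side_def)
      then show ?thesis by auto
    qed
  qed auto
qed

section \<open>Two-sided sets are not equivalent to one-sided sets\<close>

lemma real_C_set_near_zero:
  assumes "real_C_set \<sigma>" "d > 0"
  obtains y where "y \<in> \<sigma>" "y \<noteq> 0" "norm y < d"
proof -
  have "0 islimpt \<sigma>" using assms(1) by (simp add: real_C_set_def C_set_def)
  then show ?thesis using that assms(2) by (auto simp: islimpt_approachable)
qed

lemma AC_continuous_at_zero:
  assumes \<sigma>: "real_C_set \<sigma>" and f: "f \<in> AC \<sigma>" and e: "e > 0"
  obtains d where "d > 0" "\<And>z. z \<in> \<sigma> \<Longrightarrow> norm z < d \<Longrightarrow> norm (f z - f 0) \<le> e"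
proof -
  obtain g where g: "g \<in> const_near_zero \<sigma>" "bv_bound \<sigma> (\<lambda>z. f z - g z) (e / 2)"
    using f e by (auto simp: AC_eq_bv_closure[OF \<sigma>] bv_closure_def dest!: spec[of _ "e / 2"])
  obtain d where d: "d > 0" "\<And>z. z \<in> \<sigma> \<Longrightarrow> norm z < d \<Longrightarrow> g z = g 0"
    using g(1) by (auto simp: const_near_zero_def)
  have "norm (f z - f 0) \<le> e" if z: "z \<in> \<sigma>" "norm z < d" for z
  proof -
    have "f z - f 0 = (f z - g z) - (f 0 - g 0)" using d(2)[OF z] by simp
    then have "norm (f z - f 0) \<le> norm (f z - g z) + norm (f 0 - g 0)"
      by (simp only: norm_triangle_ineq4)
    also have "\<dots> \<le> e / 2 + e / 2"
      by (intro add_mono bv_bound_norm[OF g(2)] z real_C_set_zero_mem[OF \<sigma>])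
    finally show ?thesis by simp
  qed
  then show ?thesis using that d(1) by blast
qed

text \<open>An idempotent takes the values 0 and 1 only.  By continuity at \<open>0\<close> it cannot be supported at \<open>0\<close>
  alone, and if it is 1 at an isolated point \<open>y\<close>, minimality tested on the indicator of \<open>y\<close> leaves no room
  for a further point.\<close>

lemma minimal_idempotent_AC:
  assumes \<sigma>: "real_C_set \<sigma>" and e: "e \<in> AC \<sigma>" "e \<noteq> (\<lambda>z. 0)"
    and idem: "(\<lambda>z. e z * e z) = e"
    and minimal: "\<And>g. g \<in> AC \<sigma> \<Longrightarrow> \<exists>c. (\<lambda>z. g z * e z) = (\<lambda>z. c * e z)"
  shows "\<exists>y\<in>\<sigma> - {0}. e = indicator {y}"
proof -
  have val: "e z = 0 \<or> e z = 1" for z using fun_cong[OF idem, of z] by auto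
  have "\<exists>y\<in>\<sigma> - {0}. e y = 1"
  proof (rule ccontr)
    assume none: "\<not> ?thesis"
    then have zero: "e y = 0" if "y \<noteq> 0" for y using val[of y] AC_zero_outside[OF e(1), of y] that by blast
    moreover from this have "e 0 = 1" using val[of 0] e(2) by (metis ext)
    moreover obtain d where d: "d > 0" "\<And>z. z \<in> \<sigma> \<Longrightarrow> norm z < d \<Longrightarrow> norm (e z - e 0) \<le> 1 / 2"
      using AC_continuous_at_zero[OF \<sigma> e(1), of "1 / 2"] by auto
    moreover obtain y where "y \<in> \<sigma>" "y \<noteq> 0" "norm y < d" using real_C_set_near_zero[OF \<sigma> d(1)] by blast
    ultimately show False using d(2)[of y] zero[of y] by simp
  qed
  then obtain y where y: "y \<in> \<sigma> - {0}" "e y = 1" by blast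
  then have "indicator {y} \<in> AC \<sigma>" using indicator_finite_in_AC[OF \<sigma>, of "{y}"] by simp
  then obtain c where "(\<lambda>z. indicator {y} z * e z) = (\<lambda>z. c * e z)" using minimal by blast
  then have c: "indicator {y} z * e z = c * e z" for z by (rule fun_cong)
  have "c = 1" using c[of y] y(2) by simp
  then have "e z = indicator {y} z" for z using c[of z] y(2) by (cases "z = y") auto
  then show ?thesis using y(1) by blast
qed

lemma exists_closer_point:
  assumes \<sigma>: "real_C_set \<sigma>" and s: "one_sided s \<sigma>" and G: "infinite G" "G \<subseteq> \<sigma>" and r: "0 < r"
  obtains y where "y \<in> G" "y \<in> side s \<sigma>" "s * Re y < r"
proof -
  have "finite (side (- s) \<sigma> \<union> {z\<in>\<sigma>. r \<le> norm z} \<union> {0})"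
    using s real_C_set_finite_away[OF \<sigma> r] by (simp add: one_sided_def)
  then obtain y where y: "y \<in> G" "y \<notin> side (- s) \<sigma> \<union> {z\<in>\<sigma>. r \<le> norm z} \<union> {0}"
    using G(1) by (meson finite_subset subsetI)
  have sign: "s = 1 \<or> s = - 1" using s by (auto simp: one_sided_def)
  have "y \<in> side s \<sigma>" using y G(2) real_C_set_sides[OF \<sigma>] sign by auto
  moreover have "s * Re y \<le> norm y" using abs_Re_le_cmod[of y] sign by auto
  then have "s * Re y < r" using y G(2) by auto
  ultimately show ?thesis using that y(1) by blast
qed

text \<open>Two disjoint infinite subsets of a one-sided set both accumulate at \<open>0\<close> from the same side, so one
  can step towards \<open>0\<close> from one subset to the other as often as desired.  The list grows at its head.\<close>

lemma alternating_list:
  assumes \<sigma>: "real_C_set \<sigma>" and s: "one_sided s \<sigma>"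
    and E: "infinite E" "E \<subseteq> \<sigma>" and F: "infinite F" "F \<subseteq> \<sigma>" and disj: "E \<inter> F = {}"
  shows "\<exists>T. T \<noteq> [] \<and> directed_list s T \<and> set T \<subseteq> side s \<sigma> \<and> cvar (indicator E) T = real n"
proof (induction n)
  case 0
  obtain z where "z \<in> side s \<sigma>" using s by (metis one_sided_def ex_in_conv finite.emptyI)
  then show ?case by (intro exI[of _ "[z]"]) (simp add: directed_list_def)
next
  case (Suc n)
  then obtain x T where T: "directed_list s (x # T)" "set (x # T) \<subseteq> side s \<sigma>"
    "cvar (indicator E) (x # T) = real n"
    by (metis neq_Nil_conv)
  have "0 < s * Re x" using T(2) by (simp add: side_def)
  then obtain y where y: "y \<in> side s \<sigma>" "s * Re y < s * Re x" "y \<in> E \<longleftrightarrow> x \<notin> E"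
    using exists_closer_point[OF \<sigma> s E, of "s * Re x"] exists_closer_point[OF \<sigma> s F, of "s * Re x"] disj
    by (metis disjoint_iff)
  have "directed_list s (y # x # T)" using T(1) y(2) by (auto simp: directed_list_def)
  moreover have "norm (indicator E x - indicator E y :: complex) = 1"
    using y(3) by (auto simp: indicator_def)
  ultimately show ?case using T y(1) by (intro exI[of _ "y # x # T"]) simp
qed

lemma bv_bound_indicator_upper: "bv_bound \<sigma> (indicator {z\<in>\<sigma>. r \<le> Re z}) 1"
  by (rule bv_bound_majorant[where m = "\<lambda>z. of_bool (r \<le> Re z)"]) (auto simp: indicator_def)

text \<open>On minimal idempotents the isomorphism is given by an injection \<open>h\<close> of isolated points.  The
  images under \<open>h\<close> of the two halves alternate along a list \<open>T\<close> as often as wanted.  The indicator of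
  \<open>{x. r \<le> x}\<close> with small \<open>r\<close> has variation at most 1, and its image agrees on \<open>T\<close> with the indicator of the
  image of the whole positive half.\<close>

lemma two_sided_not_iso_one_sided:
  assumes \<tau>: "real_C_set \<tau>" "two_sided \<tau>" and \<sigma>: "real_C_set \<sigma>" "one_sided s \<sigma>"
  shows "\<not> banach_alg_iso (AC_alg \<tau>) (AC_alg \<sigma>)"
proof
  assume "banach_alg_iso (AC_alg \<tau>) (AC_alg \<sigma>)"
  then obtain \<Phi> where bij: "bij_betw \<Phi> (AC \<tau>) (AC \<sigma>)"
    and add: "\<And>f g. f \<in> AC \<tau> \<Longrightarrow> g \<in> AC \<tau> \<Longrightarrow> \<Phi> (\<lambda>z. f z + g z) = (\<lambda>z. \<Phi> f z + \<Phi> g z)"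
    and scale: "\<And>a f. f \<in> AC \<tau> \<Longrightarrow> \<Phi> (\<lambda>z. a * f z) = (\<lambda>z. a * \<Phi> f z)"
    and mult: "\<And>f g. f \<in> AC \<tau> \<Longrightarrow> g \<in> AC \<tau> \<Longrightarrow> \<Phi> (\<lambda>z. f z * g z) = (\<lambda>z. \<Phi> f z * \<Phi> g z)"
    and cont: "continuous_map (norm_topology (AC_alg \<tau>)) (norm_topology (AC_alg \<sigma>)) \<Phi>"
    unfolding banach_alg_iso_def AC_alg_sel by blast
  have ind_AC: "indicator A \<in> AC \<tau>" if "finite A" "A \<subseteq> \<tau> - {0}" for A
    using indicator_finite_in_AC[OF \<tau>(1) that] .
  have inj: "f = g" if "f \<in> AC \<tau>" "g \<in> AC \<tau>" "\<Phi> f = \<Phi> g" for f g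
    using bij that by (auto simp: bij_betw_def dest: inj_onD)
  have zero: "(\<lambda>z. 0) \<in> AC \<tau>" using AC_scale[OF \<tau>(1) ind_AC[of "{}"], of 0] by simp
  have \<Phi>0: "\<Phi> (\<lambda>z. 0) = (\<lambda>z. 0)" using scale[OF zero, of 0] by simp
  have "\<exists>y\<in>\<sigma> - {0}. \<Phi> (indicator {x}) = indicator {y}" if x: "x \<in> \<tau> - {0}" for x
  proof (rule minimal_idempotent_AC[OF \<sigma>(1)])
    let ?e = "indicator {x} :: complex \<Rightarrow> complex"
    have e: "?e \<in> AC \<tau>" using ind_AC[of "{x}"] x by simp
    show "\<Phi> ?e \<in> AC \<sigma>" using bij e by (auto dest: bij_betwE)
    show "\<Phi> ?e \<noteq> (\<lambda>z. 0)"
    proof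
      assume "\<Phi> ?e = (\<lambda>z. 0)"
      then have "?e = (\<lambda>z. 0)" using inj[OF e zero] \<Phi>0 by simp
      from fun_cong[OF this, of x] show False by simp
    qed
    have "(\<lambda>z. ?e z * ?e z) = ?e" by (auto simp: indicator_def)
    then show "(\<lambda>z. \<Phi> ?e z * \<Phi> ?e z) = \<Phi> ?e" using mult[OF e e] by simp
    fix g assume "g \<in> AC \<sigma>"
    then obtain f where f: "f \<in> AC \<tau>" "g = \<Phi> f" using bij by (auto simp: bij_betw_def)
    have "(\<lambda>z. f z * ?e z) = (\<lambda>z. f x * ?e z)" by (auto simp: indicator_def)
    then have "(\<lambda>z. g z * \<Phi> ?e z) = (\<lambda>z. f x * \<Phi> ?e z)"
      using mult[OF f(1) e] scale[OF e, of "f x"] f(2) by simp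
    then show "\<exists>c. (\<lambda>z. g z * \<Phi> ?e z) = (\<lambda>z. c * \<Phi> ?e z)" by blast
  qed
  then obtain h where h: "\<And>x. x \<in> \<tau> - {0} \<Longrightarrow> h x \<in> \<sigma> - {0}"
    "\<And>x. x \<in> \<tau> - {0} \<Longrightarrow> \<Phi> (indicator {x}) = indicator {h x}"
    by metis
  have inj_h: "inj_on h (\<tau> - {0})"
  proof (rule inj_onI)
    fix x y assume xy: "x \<in> \<tau> - {0}" "y \<in> \<tau> - {0}" "h x = h y"
    have "\<Phi> (indicator {x}) = \<Phi> (indicator {y})"
      unfolding h(2)[OF xy(1)] h(2)[OF xy(2)] xy(3) by (rule refl)
    then have "(indicator {x} :: complex \<Rightarrow> complex) = indicator {y}"
      using xy(1,2) inj[OF ind_AC[of "{x}"] ind_AC[of "{y}"]] by simp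
    from fun_cong[OF this, of x] show "x = y" by (simp add: indicator_def split: if_splits)
  qed
  have image: "\<Phi> (indicator A) = indicator (h ` A)" if "finite A" "A \<subseteq> \<tau> - {0}" for A
    using that
  proof (induction A rule: finite_induct)
    case empty
    have "indicator {} = (\<lambda>z::complex. 0::complex)" by (simp add: fun_eq_iff)
    then show ?case using \<Phi>0 by simp
  next
    case (insert x A)
    have split: "(indicator (insert y Y) :: complex \<Rightarrow> complex) = (\<lambda>z. indicator {y} z + indicator Y z)"
      if "y \<notin> Y" for y Y
      using that by (auto simp: indicator_def fun_eq_iff)
    have "h x \<notin> h ` A"
    proof
      assume "h x \<in> h ` A"
      then obtain y where y: "y \<in> A" "h x = h y" by blast
      then have "x = y" using inj_onD[OF inj_h y(2)] insert.prems by auto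
      then show False using y(1) insert.hyps(2) by simp
    qed
    then have 1: "(indicator (h ` insert x A) :: complex \<Rightarrow> complex) = (\<lambda>z. indicator {h x} z + indicator (h ` A) z)"
      unfolding image_insert by (rule split)
    have 2: "(indicator (insert x A) :: complex \<Rightarrow> complex) = (\<lambda>z. indicator {x} z + indicator A z)"
      using insert.hyps(2) by (rule split)
    have mem: "x \<in> \<tau> - {0}" "A \<subseteq> \<tau> - {0}" using insert.prems by auto
    have "\<Phi> (\<lambda>z. indicator {x} z + indicator A z) = (\<lambda>z. \<Phi> (indicator {x}) z + \<Phi> (indicator A) z)"
      using mem insert.hyps(1) by (intro add[OF ind_AC ind_AC]) simp_all
    then show ?case unfolding 1 2 by (simp only: h(2)[OF mem(1)] insert.IH[OF mem(2)])
  qed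
  obtain K where K: "\<And>f. f \<in> AC \<tau> \<Longrightarrow> bv_bound \<tau> f 1 \<Longrightarrow> bv_bound \<sigma> (\<Phi> f) K"
    using continuous_map_AC_bound[OF \<tau>(1) \<sigma>(1) cont scale] by blast
  have sides: "side 1 \<tau> \<subseteq> \<tau> - {0}" "side (- 1) \<tau> \<subseteq> \<tau> - {0}" by (auto simp: side_def)
  have "infinite (h ` side 1 \<tau>)" "infinite (h ` side (- 1) \<tau>)"
    using \<tau>(2) sides inj_on_subset[OF inj_h] by (auto simp: two_sided_def finite_image_iff)
  moreover have "h ` side 1 \<tau> \<subseteq> \<sigma>" "h ` side (- 1) \<tau> \<subseteq> \<sigma>" using h(1) sides by auto
  moreover have "h ` side 1 \<tau> \<inter> h ` side (- 1) \<tau> = {}"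
    using inj_on_image_Int[OF inj_h sides] by (auto simp: side_def)
  moreover obtain n where n: "K < real n" using reals_Archimedean2 by blast
  ultimately obtain T where T: "directed_list s T" "set T \<subseteq> side s \<sigma>"
    "cvar (indicator (h ` side 1 \<tau>)) T = real n"
    using alternating_list[OF \<sigma>] by metis
  have "finite (h -` set T \<inter> (\<tau> - {0}))" by (rule finite_vimage_IntI[OF _ inj_h]) simp
  from finite_set_avoid[OF this, of 0]
  obtain r where r: "r > 0" "\<And>x. x \<in> h -` set T \<inter> (\<tau> - {0}) \<Longrightarrow> r \<le> norm x" by auto
  define B where "B = {z\<in>\<tau>. r \<le> Re z}"
  have "B \<subseteq> {z\<in>\<tau>. r \<le> norm z}" using complex_Re_le_cmod order_trans by (fastforce simp: B_def)
  then have finB: "finite B" by (rule finite_subset) (rule real_C_set_finite_away[OF \<tau>(1) r(1)])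
  have B: "B \<subseteq> side 1 \<tau>" using r(1) by (auto simp: B_def side_def)
  have agree: "z \<in> h ` B \<longleftrightarrow> z \<in> h ` side 1 \<tau>" if z: "z \<in> set T" for z
  proof
    assume "z \<in> h ` side 1 \<tau>"
    then obtain x where x: "x \<in> side 1 \<tau>" "z = h x" by blast
    then have "r \<le> norm x" using r(2)[of x] z sides by auto
    moreover have "x \<in> \<real>" "0 < Re x" using x real_C_set_subset_Reals[OF \<tau>(1)] by (auto simp: side_def)
    ultimately have "r \<le> Re x" by (auto simp: complex_is_Real_iff cmod_def)
    then show "z \<in> h ` B" using x by (auto simp: B_def side_def)
  qed (use B in blast)
  have "cvar (indicator (h ` B)) T = cvar (indicator (h ` side 1 \<tau>)) T"
    unfolding cvar_def by (intro sum.cong refl) (use agree in \<open>auto simp: indicator_def\<close>)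
  moreover have "bv_bound \<sigma> (indicator (h ` B)) K"
    using K[OF ind_AC[OF finB]] image[OF finB] B sides bv_bound_indicator_upper[of \<tau> r] by (simp add: B_def)
  then have "cvar (indicator (h ` B)) T \<le> K"
    using T \<sigma>(2) by (intro bv_bound_cvar[of \<sigma> _ K s]) (auto simp: one_sided_def side_def)
  ultimately show False using T(3) n by simp
qed

section \<open>The two classes\<close>

lemma real_C_setI:
  assumes real: "\<sigma> \<subseteq> \<real>" and zero: "0 \<in> \<sigma>" and inf: "infinite \<sigma>"
    and fin: "\<And>e. e > 0 \<Longrightarrow> finite {z\<in>\<sigma>. e \<le> norm z}"
  shows "real_C_set \<sigma>"
proof -
  have away: "\<exists>n::nat. 1 / Suc n \<le> norm z" if "z \<noteq> 0" for z :: complex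
    using that reals_Archimedean[of "norm z"] by (auto simp: inverse_eq_divide intro: less_imp_le)
  have "\<sigma> \<subseteq> (\<Union>n::nat. {z\<in>\<sigma>. 1 / Suc n \<le> norm z}) \<union> {0}" using away by auto
  moreover have "countable ((\<Union>n::nat. {z\<in>\<sigma>. 1 / Suc n \<le> norm z}) \<union> {0})"
    using fin by (intro countable_Un countable_UN) (auto intro: countable_finite)
  ultimately have "countable \<sigma>" by (rule countable_subset)
  moreover have lim: "z islimpt \<sigma> \<longleftrightarrow> z = 0" for z
  proof
    assume z: "z islimpt \<sigma>"
    show "z = 0"
    proof (rule ccontr)
      assume "z \<noteq> 0"
      then have pos: "norm z / 2 > 0" by simp
      have "\<sigma> \<inter> ball z (norm z / 2) \<subseteq> {w\<in>\<sigma>. norm z / 2 \<le> norm w}"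
      proof
        fix w assume w: "w \<in> \<sigma> \<inter> ball z (norm z / 2)"
        then have "norm (z - w) < norm z / 2" by (simp add: dist_norm)
        moreover have "norm z \<le> norm (z - w) + norm w" using norm_triangle_ineq[of "z - w" w] by simp
        ultimately show "w \<in> {w\<in>\<sigma>. norm z / 2 \<le> norm w}" using w by simp
      qed
      then have "finite (\<sigma> \<inter> ball z (norm z / 2))" using fin[OF pos] by (rule finite_subset)
      then show False using z pos by (auto simp: islimpt_eq_infinite_ball)
    qed
  next
    assume "z = 0"
    have "infinite (\<sigma> \<inter> ball 0 e)" if "e > 0" for e
    proof
      assume "finite (\<sigma> \<inter> ball 0 e)"
      then have "finite ((\<sigma> \<inter> ball 0 e) \<union> {z\<in>\<sigma>. e \<le> norm z})" using fin[OF that] by simp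
      moreover have "\<sigma> \<subseteq> (\<sigma> \<inter> ball 0 e) \<union> {z\<in>\<sigma>. e \<le> norm z}" by auto
      ultimately show False using inf finite_subset by blast
    qed
    then show "z islimpt \<sigma>" using \<open>z = 0\<close> by (simp add: islimpt_eq_infinite_ball)
  qed
  moreover have "closed \<sigma>" using lim zero by (auto simp: closed_limpt)
  moreover have "bounded \<sigma>"
  proof (rule bounded_subset)
    show "\<sigma> \<subseteq> {z\<in>\<sigma>. 1 \<le> norm z} \<union> ball 0 1" by auto
    show "bounded ({z\<in>\<sigma>. 1 \<le> norm z} \<union> ball 0 1)" using fin[of 1] by (auto intro: finite_imp_bounded)
  qed
  ultimately show ?thesis using real inf by (simp add: real_C_set_def C_set_def compact_eq_bounded_closed)
qed

lemma ex_real_C_sets: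
  obtains \<sigma> \<tau> where "real_C_set \<sigma>" "one_sided 1 \<sigma>" "real_C_set \<tau>" "two_sided \<tau>"
proof -
  define u where "u n = complex_of_real (1 / Suc n)" for n :: nat
  have inj: "inj u" by (auto simp: u_def inj_def)
  have inf: "infinite (range u)" "infinite (uminus ` range u)"
    using finite_imageD[of uminus "range u"] range_inj_infinite[OF inj] by auto
  have norm_u: "norm (u n) = 1 / Suc n" for n unfolding u_def norm_of_real by simp
  have fin: "finite {z\<in>range u. e \<le> norm z}" if e: "e > 0" for e
  proof (rule finite_subset)
    show "{z\<in>range u. e \<le> norm z} \<subseteq> u ` {..nat \<lceil>1 / e\<rceil>}"
    proof
      fix z assume "z \<in> {z\<in>range u. e \<le> norm z}"
      then obtain n where n: "z = u n" "e \<le> 1 / Suc n" by (auto simp: norm_u)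
      then have "real (Suc n) \<le> 1 / e" using e by (simp add: field_simps)
      then have "n \<le> nat \<lceil>1 / e\<rceil>" by linarith
      then show "z \<in> u ` {..nat \<lceil>1 / e\<rceil>}" using n(1) by blast
    qed
  qed simp
  define \<sigma> where "\<sigma> = insert 0 (range u)"
  define \<tau> where "\<tau> = insert 0 (range u \<union> uminus ` range u)"
  have real: "u n \<in> \<real>" for n by (simp add: u_def)
  have Re: "0 < Re (u n)" for n by (simp add: u_def)
  have \<sigma>: "real_C_set \<sigma>"
  proof (rule real_C_setI)
    fix e :: real assume e: "e > 0"
    have "{z\<in>\<sigma>. e \<le> norm z} \<subseteq> {z\<in>range u. e \<le> norm z}" using e by (auto simp: \<sigma>_def)
    then show "finite {z\<in>\<sigma>. e \<le> norm z}" using fin[OF e] by (rule finite_subset)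
  qed (use inf real in \<open>auto simp: \<sigma>_def\<close>)
  have \<tau>: "real_C_set \<tau>"
  proof (rule real_C_setI)
    fix e :: real assume e: "e > 0"
    have "{z\<in>\<tau>. e \<le> norm z} \<subseteq> {z\<in>range u. e \<le> norm z} \<union> uminus ` {z\<in>range u. e \<le> norm z}"
      using e by (auto simp: \<tau>_def)
    then show "finite {z\<in>\<tau>. e \<le> norm z}" using fin[OF e] by (auto intro: finite_subset)
  qed (use inf real in \<open>auto simp: \<tau>_def\<close>)
  have "side 1 \<sigma> = range u" "side (- 1) \<sigma> = {}" using Re by (auto simp: side_def \<sigma>_def less_imp_le not_less)
  moreover have "range u \<subseteq> side 1 \<tau>" "uminus ` range u \<subseteq> side (- 1) \<tau>"
    using Re by (auto simp: side_def \<tau>_def)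
  ultimately show ?thesis
    using that \<sigma> \<tau> inf infinite_super by (metis finite.emptyI insertI1 one_sided_def two_sided_def)
qed

theorem corollary5p9:
  "equiv real_AC_algs iso_rel \<and> card (real_AC_algs // iso_rel) = 2"
proof
  have mem: "(AC_alg \<sigma>, AC_alg \<tau>) \<in> iso_rel \<longleftrightarrow> banach_alg_iso (AC_alg \<sigma>) (AC_alg \<tau>)"
    if "real_C_set \<sigma>" "real_C_set \<tau>" for \<sigma> \<tau>
    using that by (auto simp: iso_rel_def real_AC_algs_def)
  show equiv: "equiv real_AC_algs iso_rel"
  proof (rule equivI)
    show "iso_rel \<subseteq> real_AC_algs \<times> real_AC_algs" by (auto simp: iso_rel_def)
    show "refl_on real_AC_algs iso_rel"
      by (auto simp: refl_on_def iso_rel_def real_AC_algs_def banach_alg_iso_refl)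
    show "sym iso_rel"
      by (auto simp: sym_def iso_rel_def real_AC_algs_def intro: banach_alg_iso_sym)
    show "trans iso_rel"
      by (auto simp: trans_def iso_rel_def real_AC_algs_def intro: banach_alg_iso_trans)
  qed
  obtain \<sigma> \<tau> where \<sigma>: "real_C_set \<sigma>" "one_sided 1 \<sigma>" and \<tau>: "real_C_set \<tau>" "two_sided \<tau>"
    by (rule ex_real_C_sets)
  let ?C = "iso_rel `` {AC_alg \<sigma>}" and ?D = "iso_rel `` {AC_alg \<tau>}"
  have alg: "AC_alg \<sigma> \<in> real_AC_algs" "AC_alg \<tau> \<in> real_AC_algs"
    using \<sigma> \<tau> by (auto simp: real_AC_algs_def)
  have "?C \<noteq> ?D"
    using eq_equiv_class[OF _ equiv alg(1)] two_sided_not_iso_one_sided[OF \<tau> \<sigma>] mem[OF \<tau>(1) \<sigma>(1)]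
      equiv_class_eq_iff[OF equiv] by blast
  moreover have "real_AC_algs // iso_rel = {?C, ?D}"
  proof (intro equalityI subsetI)
    fix X assume "X \<in> real_AC_algs // iso_rel"
    then obtain \<upsilon> where \<upsilon>: "real_C_set \<upsilon>" "X = iso_rel `` {AC_alg \<upsilon>}"
      by (auto simp: quotient_def real_AC_algs_def)
    have "(AC_alg \<sigma>, AC_alg \<upsilon>) \<in> iso_rel \<or> (AC_alg \<tau>, AC_alg \<upsilon>) \<in> iso_rel"
      using one_or_two_sided[OF \<upsilon>(1)] one_sided_iso[OF \<upsilon>(1) \<sigma>(1) _ \<sigma>(2)] two_sided_iso[OF \<upsilon>(1) \<tau>(1) _ \<tau>(2)]
        mem \<sigma>(1) \<tau>(1) \<upsilon>(1) by blast
    then show "X \<in> {?C, ?D}" using equiv_class_eq[OF equiv] \<upsilon>(2) by blast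
  qed (use alg in \<open>auto intro: quotientI\<close>)
  ultimately show "card (real_AC_algs // iso_rel) = 2" by simp
qed

end
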